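(* Let $\beta,R,C>0$ and $x_0\in[0,1]$, and consider the Gaussian white noise model $dY_x=f(x)\,dx+n^{-1/2}\,dW_x$, $x\in[0,1]$, with $f\in\mathscr C^\beta(R)$. Assign to $(+\infty)\cdot 0$ the value $+\infty$. (i) If $\mathcal T=\{\widehat f:\ \sup_{f\in\mathscr C^\beta(R)}|\mathrm{Bias}_f(\widehat f(x_0))|<1\}$, then $$\inf_{\widehat f\in\mathcal T}\ \sup_{f\in\mathscr C^\beta(R)}\big|\mathrm{Bias}_f(\widehat f(x_0))\big|^{1/\beta}\ \sup_{f\in\mathscr C^\beta(R)}\mathrm{Var}_f(\widehat f(x_0))\ \geq\ \frac{\gamma(R,\beta)}{n}.$$ (ii) Let $\mathcal S(C):=\{\widehat f:\ \sup_{f\in\mathscr C^\beta(R)}|\mathrm{Bias}_f(\widehat f(x_0))|<(C/n)^{\beta/(2\beta+1)}\}\cap\mathcal T$. Then $$\inf_{\widehat f\in\mathcal S(C)}\ \sup_{f\in\mathscr C^\beta(R)}\big|\mathrm{Bias}_f(\widehat f(x_0))\big|^{1/\beta}\ \inf_{f\in\mathscr C^\beta(R)}\frac{\mathrm{Var}_f(\widehat f(x_0))}{\overline\gamma(R,\beta,C,\|f\|_{\mathscr C^\beta([0,1])})}\ \geq\ \frac1n.$$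
   Context: Model: one observes $Y=(Y_x)_{x\in[0,1]}$ with $dY_x=f(x)\,dx+n^{-1/2}dW_x$, $W$ an unobserved standard Brownian motion; $P_f$ is the law of $Y$, $E_f,\mathrm{Var}_f$ expectation and variance under $P_f$. An estimator $\widehat f(x_0)$ is a real-valued measurable function of $Y$ with finite expectation $E_f[\widehat f(x_0)]$ for all $f$ in the parameter space; $\mathrm{Bias}_f(\widehat f(x_0))=E_f[\widehat f(x_0)]-f(x_0)$. The variance is $+\infty$ if $\widehat f(x_0)$ is not square integrable. Hölder spaces: $\lfloor\beta\rfloor$ denotes the largest integer strictly smaller than $\beta$. For a domain $D\subseteq\mathbb R$, $$\|f\|_{\mathscr C^\beta(D)}=\sum_{\ell\le\lfloor\beta\rfloor}\|f^{(\ell)}\|_{L^\infty(D)}+\sup_{x,y\in D,\,x\ne y}\frac{|f^{(\lfloor\beta\rfloor)}(x)-f^{(\lfloor\beta\rfloor)}(y)|}{|x-y|^{\beta-\lfloor\beta\rfloor}},$$ where $L^\infty(D)$ is the supremum norm and $f^{(\ell)}$ the (strong) $\ell$-th derivative. $\mathscr C^\beta(R):=\{f:[0,1]\to\mathbb R:\|f\|_{\mathscr C^\beta([0,1])}\le R\}$ and $\mathscr C^\beta(\mathbb R):=\{K:\mathbb R\to\mathbb R:\|K\|_{\mathscr C^\beta(\mathbb R)}<\infty\}$. Constants: with $(x)_+=\max(x,0)$ and $\|K\|_2$ the $L^2(\mathbb R)$-norm (with $\|K\|_2^{-1}=0$ if $\|K\|_2=\infty$), $$\gamma(R,\beta):=\sup_{K\in\mathscr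 C^\beta(\mathbb R):K(0)=1}\Big(\|K\|_2^{-1}\Big(1-\frac{\|K\|_{\mathscr C^\beta(\mathbb R)}}{R}\Big)_+\Big)^2,$$ and for $a\in[0,R)$, $$\overline\gamma(R,\beta,C,a):=\sup_{K\in\mathscr C^\beta(\mathbb R):K(0)=1}\Big(\|K\|_2^{-1}\Big(1-\frac{\|K\|_{\mathscr C^\beta(\mathbb R)}}{R-a}\Big)_+\Big)^2\exp\Big(-C(R-a)^2\frac{\|K\|_2^2}{\|K\|_{\mathscr C^\beta(\mathbb R)}^2}\Big).$$ Conventions: $\overline\gamma(R,\beta,C,R):=0$, and a ratio with denominator $0$ is interpreted as $+\infty$. *)

theory Defs
  imports "HOL-Probability.Probability"
begin

definition std_brownian_motion :: "'a measure \<Rightarrow> (real \<Rightarrow> 'a \<Rightarrow> real) \<Rightarrow> bool" where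
  "std_brownian_motion M W \<longleftrightarrow>
     prob_space M \<and>
     (\<forall>t\<in>{0..1}. W t \<in> borel_measurable M) \<and>
     (\<forall>\<omega>\<in>space M. W 0 \<omega> = 0) \<and>
     (\<forall>\<omega>\<in>space M. continuous_on {0..1} (\<lambda>t. W t \<omega>)) \<and>
     (\<forall>s t. 0 \<le> s \<and> s < t \<and> t \<le> 1 \<longrightarrow>
        distributed M lborel (\<lambda>\<omega>. W t \<omega> - W s \<omega>) (normal_density 0 (sqrt (t - s)))) \<and>
     (\<forall>(k::nat) t. 0 \<le> t 0 \<and> (\<forall>i<k. t i < t (Suc i)) \<and> t k \<le> 1 \<longrightarrow>
        prob_space.indep_vars M (\<lambda>_. borel) (\<lambda>i \<omega>. W (t (Suc i)) \<omega> - W (t i) \<omega>) {..<k})"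

text \<open>The space of continuous paths on the unit interval, with the \<sigma>-algebra generated by the
  point evaluations (which is the Borel \<sigma>-algebra of the supremum norm). As usual for \<open>Pi\<^sub>M\<close>,
  paths take the value \<open>undefined\<close> outside the unit interval.\<close>

definition path_space :: "(real \<Rightarrow> real) measure" where
  "path_space = restrict_space (Pi\<^sub>M {0..1} (\<lambda>_. borel)) {y. continuous_on {0..1} y}"

text \<open>The integrated form of \<open>dY\<^sub>x = f(x) dx + n\<^bsup>-1/2\<^esup> dW\<^sub>x\<close>, \<open>Y\<^sub>0 = 0\<close>.\<close>

definition white_noise_obs ::
    "(real \<Rightarrow> 'a \<Rightarrow> real) \<Rightarrow> nat \<Rightarrow> (real \<Rightarrow> real) \<Rightarrow> 'a \<Rightarrow> real \<Rightarrow> real" where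
  "white_noise_obs W n f \<omega> =
     (\<lambda>x\<in>{0..1}. integral {0..x} f + real n powr (- 1 / 2) * W x \<omega>)"

definition white_noise_law ::
    "'a measure \<Rightarrow> (real \<Rightarrow> 'a \<Rightarrow> real) \<Rightarrow> nat \<Rightarrow> (real \<Rightarrow> real) \<Rightarrow> (real \<Rightarrow> real) measure" where
  "white_noise_law M W n f = distr M path_space (white_noise_obs W n f)"

definition strict_floor :: "real \<Rightarrow> nat" where
  "strict_floor \<beta> = nat (\<lceil>\<beta>\<rceil> - 1)"

lemma strict_floor_eq_Greatest:
  assumes "\<beta> > 0"
  shows "int (strict_floor \<beta>) = (GREATEST k. real_of_int k < \<beta>)"
proof -
  have "int (strict_floor \<beta>) = \<lceil>\<beta>\<rceil> - 1"
    using assms by (simp add: strict_floor_def)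
  also have "\<dots> = (GREATEST k. real_of_int k < \<beta>)"
    by (rule Greatest_equality[symmetric]) linarith+
  finally show ?thesis .
qed

text \<open>Derivatives are taken within the domain, hence one-sided at end points. Only the values of
  the function on \<open>D\<close> matter for the definitions below when \<open>D\<close> has no isolated points.\<close>

primrec deriv_within :: "real set \<Rightarrow> nat \<Rightarrow> (real \<Rightarrow> real) \<Rightarrow> real \<Rightarrow> real" where
  "deriv_within D 0 f = f"
| "deriv_within D (Suc l) f = (\<lambda>x. vector_derivative (deriv_within D l f) (at x within D))"

definition holder_norm :: "real \<Rightarrow> real set \<Rightarrow> (real \<Rightarrow> real) \<Rightarrow> ennreal" where
  "holder_norm \<beta> D f =
     (let m = strict_floor \<beta> in
      if \<forall>l<m. deriv_within D l f differentiable_on D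
      then (\<Sum>l\<le>m. SUP x\<in>D. ennreal \<bar>deriv_within D l f x\<bar>) +
           (SUP x\<in>D. SUP y\<in>D - {x}.
              ennreal (\<bar>deriv_within D m f x - deriv_within D m f y\<bar> / \<bar>x - y\<bar> powr (\<beta> - real m)))
      else \<infinity>)"

definition holder_ball :: "real \<Rightarrow> real \<Rightarrow> (real \<Rightarrow> real) set" where
  "holder_ball \<beta> R = {f. holder_norm \<beta> {0..1} f \<le> ennreal R}"

definition holder_space :: "real \<Rightarrow> (real \<Rightarrow> real) set" where
  "holder_space \<beta> = {K. holder_norm \<beta> UNIV K < \<infinity>}"

definition L2_norm :: "(real \<Rightarrow> real) \<Rightarrow> ennreal" where
  "L2_norm K =
     (let I = \<integral>\<^sup>+x. ennreal ((K x)\<^sup>2) \<partial>lborel in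
      if I = \<infinity> then \<infinity> else ennreal (sqrt (enn2real I)))"

text \<open>In \<^typ>\<open>ennreal\<close>, \<^term>\<open>inverse \<infinity> = (0::ennreal)\<close>. Below, \<^const>\<open>enn2real\<close> is applied to the
  Hoelder norm only where that norm is finite. In \<open>gamma_bar\<close>, it sends an infinite \<open>L\<^sup>2\<close>-norm to \<open>0\<close>,
  but then the first factor is \<open>0\<close>.\<close>

definition gamma_const :: "real \<Rightarrow> real \<Rightarrow> ennreal" where
  "gamma_const R \<beta> =
     (SUP K\<in>{K \<in> holder_space \<beta>. K 0 = 1}.
        (inverse (L2_norm K) * ennreal (max 0 (1 - enn2real (holder_norm \<beta> UNIV K) / R)))\<^sup>2)"

definition gamma_bar :: "real \<Rightarrow> real \<Rightarrow> real \<Rightarrow> real \<Rightarrow> ennreal" where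
  "gamma_bar R \<beta> C a =
     (if a < R then
        (SUP K\<in>{K \<in> holder_space \<beta>. K 0 = 1}.
           (inverse (L2_norm K) *
              ennreal (max 0 (1 - enn2real (holder_norm \<beta> UNIV K) / (R - a))))\<^sup>2 *
           ennreal (exp (- C * (R - a)\<^sup>2 *
              ((enn2real (L2_norm K))\<^sup>2 / (enn2real (holder_norm \<beta> UNIV K))\<^sup>2))))
      else 0)"

text \<open>Below, \<open>P\<close> is a family of laws on \<^const>\<open>path_space\<close> indexed by the regression function, \<open>F\<close>
  is the parameter space, and \<open>T\<close> is an estimator of \<open>f x\<^sub>0\<close>.\<close>

definition estimators ::
    "((real \<Rightarrow> real) \<Rightarrow> (real \<Rightarrow> real) measure) \<Rightarrow> (real \<Rightarrow> real) set \<Rightarrow> ((real \<Rightarrow> real) \<Rightarrow> real) set" where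
  "estimators P F = {T \<in> borel_measurable path_space. \<forall>f\<in>F. integrable (P f) T}"

definition Bias ::
    "((real \<Rightarrow> real) \<Rightarrow> (real \<Rightarrow> real) measure) \<Rightarrow> real \<Rightarrow> ((real \<Rightarrow> real) \<Rightarrow> real) \<Rightarrow> (real \<Rightarrow> real) \<Rightarrow> real" where
  "Bias P x\<^sub>0 T f = (\<integral>y. T y \<partial>P f) - f x\<^sub>0"

text \<open>For integrable \<open>T\<close> this is infinite iff \<open>T\<close> is not square integrable.\<close>

definition Var ::
    "((real \<Rightarrow> real) \<Rightarrow> (real \<Rightarrow> real) measure) \<Rightarrow> ((real \<Rightarrow> real) \<Rightarrow> real) \<Rightarrow> (real \<Rightarrow> real) \<Rightarrow> ennreal" where
  "Var P T f = (\<integral>\<^sup>+y. ennreal ((T y - (\<integral>z. T z \<partial>P f))\<^sup>2) \<partial>P f)"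

definition class_T ::
    "((real \<Rightarrow> real) \<Rightarrow> (real \<Rightarrow> real) measure) \<Rightarrow> (real \<Rightarrow> real) set \<Rightarrow> real \<Rightarrow> ((real \<Rightarrow> real) \<Rightarrow> real) set" where
  "class_T P F x\<^sub>0 = {T \<in> estimators P F. (SUP f\<in>F. ennreal \<bar>Bias P x\<^sub>0 T f\<bar>) < 1}"

definition class_S ::
    "((real \<Rightarrow> real) \<Rightarrow> (real \<Rightarrow> real) measure) \<Rightarrow> (real \<Rightarrow> real) set \<Rightarrow> real \<Rightarrow> nat \<Rightarrow> real \<Rightarrow> real
       \<Rightarrow> ((real \<Rightarrow> real) \<Rightarrow> real) set" where
  "class_S P F x\<^sub>0 n \<beta> C =
     {T \<in> estimators P F.
        (SUP f\<in>F. ennreal \<bar>Bias P x\<^sub>0 T f\<bar>) < ennreal ((C / real n) powr (\<beta> / (2 * \<beta> + 1)))}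
     \<inter> class_T P F x\<^sub>0"

text \<open>In \<^typ>\<open>ennreal\<close>, \<open>\<infinity> * 0 = 0\<close> and \<open>0 / 0 = 0\<close>; the conventions needed here are
  \<open>\<infinity> \<cdot> 0 = \<infinity>\<close> and \<open>a / 0 = \<infinity>\<close> for all \<open>a\<close>.\<close>

definition mult_infty :: "ennreal \<Rightarrow> ennreal \<Rightarrow> ennreal" (infixl "\<cdot>\<^sub>\<infinity>" 70) where
  "a \<cdot>\<^sub>\<infinity> b = (if a = \<infinity> \<or> b = \<infinity> then \<infinity> else a * b)"

definition ratio_infty :: "ennreal \<Rightarrow> ennreal \<Rightarrow> ennreal" (infixl "'/\<^sub>\<infinity>" 70) where
  "a /\<^sub>\<infinity> b = (if b = 0 then \<infinity> else a / b)"

end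

theory Submission
  imports Defs
begin

text \<open>For bounded \<open>\<integral>(g - f)\<^sup>2\<close> the expectations of an estimator \<open>T\<close> under \<open>P\<^sub>f\<close> and \<open>P\<^sub>g\<close> are close:
  \<open>(E\<^sub>g T - E\<^sub>f T)\<^sup>2 \<le> (exp (n \<integral>(g - f)\<^sup>2) - 1) Var\<^sub>f T\<close>, the \<open>\<chi>\<^sup>2\<close>-divergence being computed from the
  independent Gaussian increments over dyadic intervals. On the other hand, small bias forces the
  expectations apart. Perturb \<open>f\<close> by \<open>\<plusminus>c h\<^sup>\<beta> K((x - x\<^sub>0) / h)\<close>, where \<open>c\<close> is as large as the Hoelder ball
  allows and \<open>h\<^sup>\<beta>\<close> is the maximal bias: the two expectations differ by at least
  \<open>2 (c - 1) h\<^sup>\<beta>\<close>, whereas the squared \<open>L\<^sup>2\<close>-norm of the perturbation is at most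
  \<open>c\<^sup>2 h\<^bsup>2\<beta>+1\<^esup>\<close> times that of \<open>K\<close>. For (ii) the perturbation is around \<open>f\<close>, and the constraint on the bias bounds the
  exponent; for (i) it is around \<open>0\<close>, and summing the inequality over a fine subdivision of the
  segment between the two perturbations removes the exponential.\<close>

section \<open>Change of expectation\<close>

text \<open>The \<chi>^2 form of the comparison is chosen for its asymmetry: only the variance at
  one of the two functions enters, so each single \<open>f\<close> yields a bound for its own
  variance, as (ii) demands. The subdivision in (i) uses the variance at every intermediate point.
  It therefore gives a bound for the supremum of the variances only, and at a fixed \<open>f\<close>
  the exponential stays. The power 1/\<beta> of the bias comes from scaling. The squared gap is of
  order h^(2\<beta>), the energy of order h^(2\<beta>+1); their quotient leaves one factor h, and h
  is the maximal bias to the power 1/\<beta>. A bias below 1 gives h \<le> 1, which keeps the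
  derivatives of h^\<beta> K((x - x0) / h) below those of K. The gap c - 1 is positive only if the
  norm of K is smaller than the room left in the ball; the remaining kernels contribute 0 to the
  suprema. An unbiased estimator has no positive bandwidth of its own, so the inequalities for one
  kernel are proved for every admissible h at or above the bias level.\<close>

lemma integrable_mult_square_integrable:
  fixes u v :: "'b \<Rightarrow> real"
  assumes [measurable]: "u \<in> borel_measurable N" "v \<in> borel_measurable N"
    and "integrable N (\<lambda>x. (u x)\<^sup>2)" "integrable N (\<lambda>x. (v x)\<^sup>2)"
  shows "integrable N (\<lambda>x. u x * v x)"
proof (rule Bochner_Integration.integrable_bound)
  show "integrable N (\<lambda>x. (u x)\<^sup>2 + (v x)\<^sup>2)"
    using assms by simp
  have "\<bar>a * b\<bar> \<le> \<bar>a\<^sup>2 + b\<^sup>2\<bar>" for a b :: real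
  proof -
    have "2 * (\<bar>a\<bar> * \<bar>b\<bar>) \<le> a\<^sup>2 + b\<^sup>2"
      using sum_squares_bound[of "\<bar>a\<bar>" "\<bar>b\<bar>"] by (simp add: mult.assoc)
    moreover have "0 \<le> \<bar>a\<bar> * \<bar>b\<bar>" by simp
    ultimately show ?thesis unfolding abs_mult by linarith
  qed
  then show "AE x in N. norm (u x * v x) \<le> norm ((u x)\<^sup>2 + (v x)\<^sup>2)" by simp
qed measurable

lemma Cauchy_Schwarz_integral:
  fixes u v :: "'b \<Rightarrow> real"
  assumes [measurable]: "u \<in> borel_measurable N" "v \<in> borel_measurable N"
    and iu: "integrable N (\<lambda>x. (u x)\<^sup>2)" and iv: "integrable N (\<lambda>x. (v x)\<^sup>2)"
  shows "(\<integral>x. u x * v x \<partial>N)\<^sup>2 \<le> (\<integral>x. (u x)\<^sup>2 \<partial>N) * (\<integral>x. (v x)\<^sup>2 \<partial>N)"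
proof -
  have i: "integrable N (\<lambda>x. u x * v x)"
    by (rule integrable_mult_square_integrable) (use assms in auto)
  have "(\<integral>\<^sup>+x. ennreal \<bar>u x\<bar> * ennreal \<bar>v x\<bar> \<partial>N)\<^sup>2
      \<le> (\<integral>\<^sup>+x. (ennreal \<bar>u x\<bar>)\<^sup>2 \<partial>N) * (\<integral>\<^sup>+x. (ennreal \<bar>v x\<bar>)\<^sup>2 \<partial>N)"
    by (rule Cauchy_Schwarz_nn_integral) measurable
  also have "\<dots> = ennreal ((\<integral>x. (u x)\<^sup>2 \<partial>N) * (\<integral>x. (v x)\<^sup>2 \<partial>N))"
    using iu iv by (simp add: ennreal_power nn_integral_eq_integral ennreal_mult)
  also have "(\<integral>\<^sup>+x. ennreal \<bar>u x\<bar> * ennreal \<bar>v x\<bar> \<partial>N) = ennreal (\<integral>x. \<bar>u x * v x\<bar> \<partial>N)"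
    using nn_integral_eq_integral[OF integrable_abs[OF i]]
    by (simp add: ennreal_mult[symmetric] abs_mult)
  finally have "(\<integral>x. \<bar>u x * v x\<bar> \<partial>N)\<^sup>2 \<le> (\<integral>x. (u x)\<^sup>2 \<partial>N) * (\<integral>x. (v x)\<^sup>2 \<partial>N)"
    by (simp add: ennreal_power mult_nonneg_nonneg)
  moreover have "\<bar>\<integral>x. u x * v x \<partial>N\<bar> \<le> (\<integral>x. \<bar>u x * v x\<bar> \<partial>N)"
    by (rule integral_abs_bound)
  then have "(\<integral>x. u x * v x \<partial>N)\<^sup>2 \<le> (\<integral>x. \<bar>u x * v x\<bar> \<partial>N)\<^sup>2"
    by (metis abs_ge_zero power2_abs power_mono)
  ultimately show ?thesis by linarith
qed

text \<open>Since L integrates to 1, the difference of expectations equals the integral of (L -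
  1)(\<phi> - m) for every constant m, and Cauchy-Schwarz separates the factors; c is the
  \<chi>^2-divergence. Leaving m free allows approximants of an estimator to be centred at the mean
  of the estimator instead of their own.\<close>

lemma chi_square_bound_density:
  fixes L \<phi> :: "'b \<Rightarrow> real"
  assumes "prob_space P" and [measurable]: "L \<in> borel_measurable P" "\<phi> \<in> borel_measurable P"
    and L0: "\<And>x. 0 \<le> L x" and L1: "(\<integral>\<^sup>+x. ennreal (L x) \<partial>P) = 1"
    and L2: "(\<integral>\<^sup>+x. ennreal ((L x)\<^sup>2) \<partial>P) = ennreal (1 + c)" and "0 \<le> c"
    and bd: "\<And>x. \<bar>\<phi> x\<bar> \<le> B"
  shows "((\<integral>x. \<phi> x \<partial>density P L) - (\<integral>x. \<phi> x \<partial>P))\<^sup>2 \<le> c * (\<integral>x. (\<phi> x - m)\<^sup>2 \<partial>P)"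
proof -
  interpret prob_space P by fact
  have iL: "integrable P L"
    using L0 L1 by (intro integrableI_nonneg) auto
  have iL2: "integrable P (\<lambda>x. (L x)\<^sup>2)"
    using L0 L2 by (intro integrableI_nonneg) auto
  have eL: "(\<integral>x. L x \<partial>P) = 1"
    by (rule integral_eq_nn_integral[THEN trans]) (use L0 L1 in auto)
  have eL2: "(\<integral>x. (L x)\<^sup>2 \<partial>P) = 1 + c"
    by (rule integral_eq_nn_integral[THEN trans]) (use L0 L2 \<open>0 \<le> c\<close> in auto)
  have i1: "integrable P (\<lambda>x. (L x - 1)\<^sup>2)"
    using iL iL2 by (simp add: power2_diff)
  have e1: "(\<integral>x. (L x - 1)\<^sup>2 \<partial>P) = c"
    using iL iL2 eL eL2 by (simp add: power2_diff prob_space)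
  have i\<phi>: "integrable P \<phi>"
    by (rule integrable_const_bound[of _ B]) (use bd in auto)
  have i\<phi>2: "integrable P (\<lambda>x. (\<phi> x - m)\<^sup>2)"
  proof (rule integrable_const_bound[of _ "(B + \<bar>m\<bar>)\<^sup>2"])
    have "\<bar>\<phi> x - m\<bar> \<le> B + \<bar>m\<bar>" for x using bd[of x] by linarith
    then have "(\<phi> x - m)\<^sup>2 \<le> (B + \<bar>m\<bar>)\<^sup>2" for x
      by (metis abs_ge_zero power2_abs power_mono)
    then show "AE x in P. norm ((\<phi> x - m)\<^sup>2) \<le> (B + \<bar>m\<bar>)\<^sup>2" by simp
  qed measurable
  have i2: "integrable P (\<lambda>x. (L x - 1) * (\<phi> x - m))"
    by (rule integrable_mult_square_integrable) (use i1 i\<phi>2 in auto)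
  have "(\<lambda>x. L x * \<phi> x) = (\<lambda>x. (L x - 1) * (\<phi> x - m) + \<phi> x + m * L x - m)"
    by (auto simp: algebra_simps)
  moreover have "(\<integral>x. (L x - 1) * (\<phi> x - m) + \<phi> x + m * L x - m \<partial>P)
      = (\<integral>x. (L x - 1) * (\<phi> x - m) \<partial>P) + (\<integral>x. \<phi> x \<partial>P) + m - m"
    using i2 i\<phi> iL eL by (simp add: prob_space)
  ultimately have "(\<integral>x. L x * \<phi> x \<partial>P) - (\<integral>x. \<phi> x \<partial>P) = (\<integral>x. (L x - 1) * (\<phi> x - m) \<partial>P)"
    by simp
  moreover have "(\<integral>x. \<phi> x \<partial>density P L) = (\<integral>x. L x * \<phi> x \<partial>P)"
    using L0 by (subst integral_real_density) auto
  moreover have "(\<integral>x. (L x - 1) * (\<phi> x - m) \<partial>P)\<^sup>2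
      \<le> (\<integral>x. (L x - 1)\<^sup>2 \<partial>P) * (\<integral>x. (\<phi> x - m)\<^sup>2 \<partial>P)"
    by (rule Cauchy_Schwarz_integral) (use i1 i\<phi>2 in auto)
  ultimately show ?thesis by (simp add: e1)
qed

section \<open>Products of Gaussian measures\<close>

text \<open>A product measure is determined by its values on rectangles. There the indicator
  factorises like the density, so the integral becomes a product of one-dimensional
  integrals.\<close>

lemma PiM_density:
  fixes M :: "'i \<Rightarrow> 'b measure" and f :: "'i \<Rightarrow> 'b \<Rightarrow> ennreal"
  assumes "finite I" and M: "\<And>i. prob_space (M i)" and D: "\<And>i. prob_space (density (M i) (f i))"
    and [measurable]: "\<And>i. f i \<in> borel_measurable (M i)"
  shows "PiM I (\<lambda>i. density (M i) (f i)) = density (PiM I M) (\<lambda>x. \<Prod>i\<in>I. f i (x i))"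
proof (rule sym)
  interpret M: product_prob_space M I
    by (rule product_prob_spaceI) (rule M)
  interpret D: product_prob_space "\<lambda>i. density (M i) (f i)" I
    by (rule product_prob_spaceI) (rule D)
  have sets_eq: "sets (PiM I (\<lambda>i. density (M i) (f i))) = sets (PiM I M)"
    by (rule sets_PiM_cong) auto
  show "density (PiM I M) (\<lambda>x. \<Prod>i\<in>I. f i (x i)) = PiM I (\<lambda>i. density (M i) (f i))"
  proof (rule D.PiM_eqI)
    fix A assume A: "\<And>i. i \<in> I \<Longrightarrow> A i \<in> sets (density (M i) (f i))"
    then have Am: "\<And>i. i \<in> I \<Longrightarrow> A i \<in> sets (M i)" by simp
    have [measurable]: "Pi\<^sub>E I A \<in> sets (PiM I M)"
      by (rule sets_PiM_I_finite) (use Am \<open>finite I\<close> in auto)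
    have "emeasure (density (PiM I M) (\<lambda>x. \<Prod>i\<in>I. f i (x i))) (Pi\<^sub>E I A)
        = (\<integral>\<^sup>+x. (\<Prod>i\<in>I. f i (x i)) * indicator (Pi\<^sub>E I A) x \<partial>PiM I M)"
      using \<open>finite I\<close> by (subst emeasure_density) auto
    also have "\<dots> = (\<integral>\<^sup>+x. (\<Prod>i\<in>I. f i (x i) * indicator (A i) (x i)) \<partial>PiM I M)"
    proof (rule nn_integral_cong)
      fix x assume "x \<in> space (PiM I M)"
      then have "x \<in> extensional I" by (auto simp: space_PiM PiE_def)
      then have "(indicator (Pi\<^sub>E I A) x :: ennreal) = (\<Prod>i\<in>I. indicator (A i) (x i))"
        using \<open>finite I\<close> by (auto simp: indicator_def PiE_iff prod_zero_iff)
      then show "(\<Prod>i\<in>I. f i (x i)) * indicator (Pi\<^sub>E I A) x = (\<Prod>i\<in>I. f i (x i) * indicator (A i) (x i))"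
        by (simp add: prod.distrib)
    qed
    also have "\<dots> = (\<Prod>i\<in>I. \<integral>\<^sup>+x. f i x * indicator (A i) x \<partial>M i)"
      by (rule M.product_nn_integral_prod) (use \<open>finite I\<close> Am in auto)
    also have "\<dots> = (\<Prod>i\<in>I. emeasure (density (M i) (f i)) (A i))"
      by (rule prod.cong[OF refl]) (use Am in \<open>auto simp: emeasure_density\<close>)
    finally show "emeasure (density (PiM I M) (\<lambda>x. \<Prod>i\<in>I. f i (x i))) (Pi\<^sub>E I A) = \<dots>" .
  qed (use \<open>finite I\<close> sets_eq in auto)
qed

text \<open>Completing the square: 2(x - b)^2 - (x - a)^2 = (x - (2b - a))^2 - 2(b - a)^2. The
  right-hand side is a constant times a Gaussian density, so this constant is the second moment of
  the likelihood ratio.\<close>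

lemma normal_density_ratio_square:
  assumes "0 < \<sigma>"
  shows "(normal_density b \<sigma> x / normal_density a \<sigma> x)\<^sup>2 * normal_density a \<sigma> x
      = exp ((b - a)\<^sup>2 / \<sigma>\<^sup>2) * normal_density (2 * b - a) \<sigma> x"
proof -
  define e where "e = (\<lambda>c. exp (- (x - c)\<^sup>2 / (2 * \<sigma>\<^sup>2)))"
  have nd: "normal_density c \<sigma> x = e c / sqrt (2 * pi * \<sigma>\<^sup>2)" for c
    by (simp add: normal_density_def e_def)
  have "(e b)\<^sup>2 = exp ((b - a)\<^sup>2 / \<sigma>\<^sup>2) * e (2 * b - a) * e a"
    unfolding e_def exp_double[symmetric] exp_add[symmetric]
    using assms by (simp add: field_simps power2_eq_square)
  moreover have "e a > 0" "sqrt (2 * pi * \<sigma>\<^sup>2) > 0" using assms by (auto simp: e_def)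
  ultimately show ?thesis
    unfolding nd by (simp add: field_simps power2_eq_square)
qed

text \<open>The likelihood ratio is a product over the coordinates. By independence its second
  moment is the product of the coordinate second moments, so the exponents add up.\<close>

lemma chi_square_bound_normal:
  fixes \<phi> :: "('i \<Rightarrow> real) \<Rightarrow> real" and a b :: "'i \<Rightarrow> real"
  assumes "finite I" "0 < \<sigma>" and \<phi>: "\<phi> \<in> borel_measurable (PiM I (\<lambda>_. borel))"
    and bd: "\<And>x. \<bar>\<phi> x\<bar> \<le> B"
  defines "G \<equiv> \<lambda>a. PiM I (\<lambda>i. density lborel (normal_density (a i) \<sigma>))"
  shows "((\<integral>x. \<phi> x \<partial>G b) - (\<integral>x. \<phi> x \<partial>G a))\<^sup>2
      \<le> (exp (\<Sum>i\<in>I. (b i - a i)\<^sup>2 / \<sigma>\<^sup>2) - 1) * (\<integral>x. (\<phi> x - m)\<^sup>2 \<partial>G a)"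
proof -
  define l where "l = (\<lambda>i x. normal_density (b i) \<sigma> x / normal_density (a i) \<sigma> x)"
  define N where "N = (\<lambda>i. density lborel (\<lambda>x. ennreal (normal_density (a i) \<sigma> x)))"
  have pos: "0 < normal_density c \<sigma> x" for c x using normal_density_pos \<open>0 < \<sigma>\<close> by blast
  have [measurable]: "l i \<in> borel_measurable borel" for i unfolding l_def by measurable
  have l0: "0 \<le> l i x" for i x using pos by (simp add: l_def less_imp_le)
  have prob: "prob_space (density lborel (\<lambda>x. ennreal (normal_density c \<sigma> x)))" for c
    by (rule prob_space_normal_density) fact
  have prob_N: "prob_space (N i)" for i unfolding N_def by (rule prob)
  have [measurable_cong]: "sets (N i) = sets borel" for i by (simp add: N_def)
  interpret N: product_prob_space N I
    by (rule product_prob_spaceI) (rule prob_N)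
  have dens: "density (N i) (\<lambda>x. ennreal (l i x)) = density lborel (\<lambda>x. ennreal (normal_density (b i) \<sigma> x))" for i
    unfolding N_def l_def using pos[THEN less_imp_le] pos[THEN less_imp_neq]
    by (subst density_density_eq) (auto simp: ennreal_mult[symmetric] intro!: density_cong)
  have Gb: "G b = density (PiM I N) (\<lambda>x. ennreal (\<Prod>i\<in>I. l i (x i)))"
  proof -
    have "G b = PiM I (\<lambda>i. density (N i) (\<lambda>x. ennreal (l i x)))"
      by (simp add: G_def dens)
    also have "\<dots> = density (PiM I N) (\<lambda>x. \<Prod>i\<in>I. ennreal (l i (x i)))"
      by (rule PiM_density) (use \<open>finite I\<close> prob prob_N in \<open>auto simp: dens\<close>)
    finally show ?thesis by (simp add: prod_ennreal l0)
  qed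
  have Ga: "G a = PiM I N" by (simp add: G_def N_def)
  have int1: "(\<integral>\<^sup>+x. ennreal (l i x) \<partial>N i) = 1" for i
  proof -
    have "(\<integral>\<^sup>+x. ennreal (l i x) \<partial>N i) = emeasure (density (N i) (\<lambda>x. ennreal (l i x))) (space (N i))"
      by (subst emeasure_density) (auto intro!: nn_integral_cong)
    also have "\<dots> = 1"
      using prob_space.emeasure_space_1[OF prob[of "b i"]] unfolding dens by (simp add: N_def)
    finally show ?thesis .
  qed
  have int2: "(\<integral>\<^sup>+x. ennreal ((l i x)\<^sup>2) \<partial>N i) = ennreal (exp ((b i - a i)\<^sup>2 / \<sigma>\<^sup>2))" for i
  proof -
    have "(\<integral>\<^sup>+x. ennreal ((l i x)\<^sup>2) \<partial>N i)
        = (\<integral>\<^sup>+x. ennreal (exp ((b i - a i)\<^sup>2 / \<sigma>\<^sup>2)) * ennreal (normal_density (2 * b i - a i) \<sigma> x) \<partial>lborel)"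
      unfolding N_def using normal_density_ratio_square[OF \<open>0 < \<sigma>\<close>, of "b i" _ "a i"]
      by (subst nn_integral_density)
         (auto simp: ennreal_mult[symmetric] l_def mult.commute intro!: nn_integral_cong)
    also have "\<dots> = ennreal (exp ((b i - a i)\<^sup>2 / \<sigma>\<^sup>2))"
      using prob_space.emeasure_space_1[OF prob[of "2 * b i - a i"]]
      by (subst nn_integral_cmult) (auto simp: emeasure_density)
    finally show ?thesis .
  qed
  show ?thesis unfolding Ga Gb
  proof (rule chi_square_bound_density)
    show "prob_space (PiM I N)" by unfold_locales
    have "(\<integral>\<^sup>+x. ennreal (\<Prod>i\<in>I. l i (x i)) \<partial>PiM I N) = (\<Prod>i\<in>I. \<integral>\<^sup>+x. ennreal (l i x) \<partial>N i)"
      unfolding prod_ennreal[OF l0, symmetric]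
      by (rule N.product_nn_integral_prod) (use \<open>finite I\<close> in auto)
    then show "(\<integral>\<^sup>+x. ennreal (\<Prod>i\<in>I. l i (x i)) \<partial>PiM I N) = 1" by (simp add: int1)
    have "(\<integral>\<^sup>+x. ennreal ((\<Prod>i\<in>I. l i (x i))\<^sup>2) \<partial>PiM I N)
        = (\<integral>\<^sup>+x. (\<Prod>i\<in>I. ennreal ((l i (x i))\<^sup>2)) \<partial>PiM I N)"
      by (simp add: prod_ennreal prod_power_distrib)
    also have "\<dots> = (\<Prod>i\<in>I. \<integral>\<^sup>+x. ennreal ((l i x)\<^sup>2) \<partial>N i)"
      by (rule N.product_nn_integral_prod) (use \<open>finite I\<close> in auto)
    also have "\<dots> = ennreal (1 + (exp (\<Sum>i\<in>I. (b i - a i)\<^sup>2 / \<sigma>\<^sup>2) - 1))"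
      using \<open>finite I\<close> by (simp add: int2 prod_ennreal exp_sum)
    finally show "(\<integral>\<^sup>+x. ennreal ((\<Prod>i\<in>I. l i (x i))\<^sup>2) \<partial>PiM I N) = \<dots>" .
    show "0 \<le> exp (\<Sum>i\<in>I. (b i - a i)\<^sup>2 / \<sigma>\<^sup>2) - 1"
      by (simp add: sum_nonneg)
    show "\<phi> \<in> borel_measurable (PiM I N)"
      using \<phi> by (simp add: N_def cong: measurable_cong_sets sets_PiM_cong)
    show "(\<lambda>x. \<Prod>i\<in>I. l i (x i)) \<in> borel_measurable (PiM I N)" by measurable
  qed (use l0 bd in \<open>auto intro: prod_nonneg\<close>)
qed

section \<open>From an algebra of events to the whole sigma-algebra\<close>

text \<open>This replaces Girsanov's theorem: a change-of-expectation bound for cylinder functionals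
  passes to all measurable functionals, so that no likelihood ratio on path space is needed.\<close>

lemma sigma_algebra_approximable:
  assumes "finite_measure P" "finite_measure Q" and sets_eq: "sets Q = sets P" and sub: "\<A> \<subseteq> sets P"
    and Un: "\<And>A B. A \<in> \<A> \<Longrightarrow> B \<in> \<A> \<Longrightarrow> A \<union> B \<in> \<A>"
    and Compl: "\<And>A. A \<in> \<A> \<Longrightarrow> space P - A \<in> \<A>" and ne: "{} \<in> \<A>"
  shows "sigma_algebra (space P)
    {A \<in> sets P. \<forall>\<epsilon>>0. \<exists>B\<in>\<A>. measure P (sym_diff A B) + measure Q (sym_diff A B) < \<epsilon>}"
proof -
  interpret P: finite_measure P by fact
  interpret Q: finite_measure Q by fact
  note [measurable_cong] = sets_eq
  define \<mu> where "\<mu> = (\<lambda>A. measure P A + measure Q A)"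
  define \<S> where "\<S> = {A \<in> sets P. \<forall>\<epsilon>>0. \<exists>B\<in>\<A>. \<mu> (sym_diff A B) < \<epsilon>}"
  have S_iff: "A \<in> \<S> \<longleftrightarrow> A \<in> sets P \<and> (\<forall>\<epsilon>>0. \<exists>B\<in>\<A>. \<mu> (sym_diff A B) < \<epsilon>)" for A
    by (simp add: \<S>_def)
  have mono: "\<mu> A \<le> \<mu> B" if "A \<subseteq> B" "B \<in> sets P" for A B
    unfolding \<mu>_def using that sets_eq by (intro add_mono P.finite_measure_mono Q.finite_measure_mono) auto
  have subadd: "\<mu> (A \<union> B) \<le> \<mu> A + \<mu> B" if "A \<in> sets P" "B \<in> sets P" for A B
    using measure_Un_le[of A P B] measure_Un_le[of A Q B] that sets_eq by (simp add: \<mu>_def)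
  have subadd_UN: "\<mu> (\<Union>i<k. A i) \<le> (\<Sum>i<k. \<mu> (A i))" if "\<And>i. A i \<in> sets P" for A :: "nat \<Rightarrow> _" and k
    unfolding \<mu>_def sum.distrib using that sets_eq
    by (intro add_mono P.finite_measure_subadditive_finite Q.finite_measure_subadditive_finite) auto
  have Compl': "space P - A \<in> \<S>" if A: "A \<in> \<S>" for A
  proof -
    have "\<exists>B\<in>\<A>. \<mu> (sym_diff (space P - A) B) < \<epsilon>" if "\<epsilon> > 0" for \<epsilon> :: real
    proof -
      obtain B where B: "B \<in> \<A>" "\<mu> (sym_diff A B) < \<epsilon>" using A \<open>\<epsilon> > 0\<close> unfolding S_iff by blast
      have "sym_diff (space P - A) (space P - B) = sym_diff A B"
        using A B(1) sub sets.sets_into_space[of _ P] unfolding S_iff by blast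
      with B Compl show ?thesis by (metis (no_types, lifting))
    qed
    moreover have "space P - A \<in> sets P" using A unfolding S_iff by blast
    ultimately show ?thesis unfolding S_iff by blast
  qed
  have Un': "(\<Union>i::nat. A i) \<in> \<S>" if A: "range A \<subseteq> \<S>" for A
  proof -
    have Am [measurable]: "A i \<in> sets P" for i using A \<S>_def by blast
    have "\<exists>B\<in>\<A>. \<mu> (sym_diff (\<Union>i. A i) B) < \<epsilon>" if "\<epsilon> > 0" for \<epsilon> :: real
    proof -
      \<comment> \<open>Half of \<epsilon> is spent on cutting the countable union off at a finite
        k, the other half on approximating the k remaining sets.\<close>
      have inc: "incseq (\<lambda>k. \<Union>i<k. A i)" by (rule incseq_SucI) (auto simp: lessThan_Suc)
      have rP: "range (\<lambda>k. \<Union>i<k. A i) \<subseteq> sets P" by auto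
      then have rQ: "range (\<lambda>k. \<Union>i<k. A i) \<subseteq> sets Q" by (simp add: sets_eq)
      have "(\<lambda>k. \<mu> (\<Union>i<k. A i)) \<longlonglongrightarrow> \<mu> (\<Union>k. \<Union>i<k. A i)"
        unfolding \<mu>_def
        by (intro tendsto_add P.finite_Lim_measure_incseq[OF rP inc] Q.finite_Lim_measure_incseq[OF rQ inc])
      moreover have "(\<Union>k. \<Union>i<k. A i) = (\<Union>i. A i)" by auto
      ultimately have "(\<lambda>k. \<mu> (\<Union>i<k. A i)) \<longlonglongrightarrow> \<mu> (\<Union>i. A i)" by simp
      from LIMSEQ_D[OF this, of "\<epsilon> / 2"] \<open>\<epsilon> > 0\<close>
      obtain k where k: "\<bar>\<mu> (\<Union>i<k. A i) - \<mu> (\<Union>i. A i)\<bar> < \<epsilon> / 2" by auto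
      have "\<mu> ((\<Union>i. A i) - (\<Union>i<k. A i)) = \<mu> (\<Union>i. A i) - \<mu> (\<Union>i<k. A i)"
      proof -
        have "(\<Union>i. A i) \<in> sets R" "(\<Union>i<k. A i) \<in> sets R" if "sets R = sets P" for R
          unfolding that by measurable
        moreover have "(\<Union>i<k. A i) \<subseteq> (\<Union>i. A i)" by blast
        ultimately show ?thesis
          unfolding \<mu>_def by (simp add: P.finite_measure_Diff Q.finite_measure_Diff sets_eq)
      qed
      with k have tail: "\<mu> ((\<Union>i. A i) - (\<Union>i<k. A i)) < \<epsilon> / 2" by linarith
      \<comment> \<open>The denominator has k + 1 instead of k because the cut-off may be at k =
        0.\<close>
      have "\<forall>i. \<exists>B\<in>\<A>. \<mu> (sym_diff (A i) B) < \<epsilon> / (2 * (real k + 1))"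
      proof
        fix i
        have "A i \<in> \<S>" "\<epsilon> / (2 * (real k + 1)) > 0" using A \<open>\<epsilon> > 0\<close> by auto
        then show "\<exists>B\<in>\<A>. \<mu> (sym_diff (A i) B) < \<epsilon> / (2 * (real k + 1))" unfolding S_iff by blast
      qed
      then obtain B where B: "\<And>i. B i \<in> \<A>" "\<And>i. \<mu> (sym_diff (A i) (B i)) < \<epsilon> / (2 * (real k + 1))"
        by metis
      have Bm [measurable]: "B i \<in> sets P" for i using B sub by auto
      have fin: "(\<Union>i<j. B i) \<in> \<A>" for j
        by (induction j) (auto simp: lessThan_Suc ne intro!: Un B)
      have "\<mu> (sym_diff (\<Union>i. A i) (\<Union>i<k. B i))
          \<le> \<mu> (((\<Union>i. A i) - (\<Union>i<k. A i)) \<union> (\<Union>i<k. sym_diff (A i) (B i)))"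
        by (rule mono) (blast, measurable)
      also have "\<dots> \<le> \<mu> ((\<Union>i. A i) - (\<Union>i<k. A i)) + \<mu> (\<Union>i<k. sym_diff (A i) (B i))"
        by (rule subadd) measurable
      also have "\<mu> (\<Union>i<k. sym_diff (A i) (B i)) \<le> (\<Sum>i<k. \<mu> (sym_diff (A i) (B i)))"
        by (rule subadd_UN) measurable
      also have "\<dots> \<le> (\<Sum>i<k. \<epsilon> / (2 * (real k + 1)))"
        by (rule sum_mono) (rule less_imp_le[OF B(2)])
      also have "\<dots> \<le> \<epsilon> / 2" using \<open>\<epsilon> > 0\<close> by (simp add: field_simps)
      finally have "\<mu> (sym_diff (\<Union>i. A i) (\<Union>i<k. B i)) < \<epsilon>" using tail by linarith
      with fin show ?thesis by blast
    qed
    then show ?thesis unfolding S_iff by (auto intro!: sets.countable_UN)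
  qed
  have "{} \<in> \<S>" unfolding S_iff using ne by (auto simp: \<mu>_def intro!: bexI[OF _ ne])
  moreover have "\<S> \<subseteq> Pow (space P)" using sets.sets_into_space by (auto simp: \<S>_def)
  ultimately have "sigma_algebra (space P) \<S>"
    using Compl' Un' unfolding sigma_algebra_iff2 by blast
  then show ?thesis by (simp add: \<S>_def \<mu>_def)
qed

text \<open>Both sides of the inequality are continuous along two approximations: simple functions
  are approximated by simple functions with level sets in \<A>, and T by simple functions dominated
  by 2|T|. The constant m stays the same throughout. The index set consists of reals because the
  level sets of a simple function are indexed by its values.\<close>

lemma chi_square_bound_extend:
  fixes T :: "'b \<Rightarrow> real"
  assumes P: "prob_space P" and Q: "prob_space Q" and sets_eq: "sets Q = sets P"
    and sub: "\<A> \<subseteq> sets P"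
    and approx: "\<And>A \<epsilon>. A \<in> sets P \<Longrightarrow> \<epsilon> > 0 \<Longrightarrow>
      \<exists>B\<in>\<A>. measure P (sym_diff A B) < \<epsilon> \<and> measure Q (sym_diff A B) < \<epsilon>"
    and simple: "\<And>(I :: real set) r B m. finite I \<Longrightarrow> (\<And>i. i \<in> I \<Longrightarrow> B i \<in> \<A>) \<Longrightarrow>
      ((\<integral>x. (\<Sum>i\<in>I. r i * indicator (B i) x) \<partial>Q) - (\<integral>x. (\<Sum>i\<in>I. r i * indicator (B i) x) \<partial>P))\<^sup>2
        \<le> c * (\<integral>x. ((\<Sum>i\<in>I. r i * indicator (B i) x) - m)\<^sup>2 \<partial>P)"
    and T [measurable]: "T \<in> borel_measurable P" and TQ: "integrable Q T"
    and TP: "integrable P (\<lambda>x. (T x)\<^sup>2)"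
  shows "((\<integral>x. T x \<partial>Q) - (\<integral>x. T x \<partial>P))\<^sup>2 \<le> c * (\<integral>x. (T x - m)\<^sup>2 \<partial>P)"
proof -
  interpret P: prob_space P by fact
  interpret Q: prob_space Q by fact
  note [measurable_cong] = sets_eq
  have S: "((\<integral>x. s x \<partial>Q) - (\<integral>x. s x \<partial>P))\<^sup>2 \<le> c * (\<integral>x. (s x - m)\<^sup>2 \<partial>P)"
    if s: "simple_function P s" for s :: "'b \<Rightarrow> real"
  proof -
    define I where "I = s ` space P"
    have fI: "finite I" using simple_functionD(1)[OF s] by (simp add: I_def)
    define A where "A = (\<lambda>i. s -` {i} \<inter> space P)"
    have A: "A i \<in> sets P" for i unfolding A_def using simple_functionD(2)[OF s] .
    define S where "S = (\<lambda>x. \<Sum>i\<in>I. i * indicator (A i) x)"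
    have s_eq: "s x = S x" if "x \<in> space P" for x
    proof -
      have "S x = (\<Sum>i\<in>I. if i = s x then i else 0)"
        unfolding S_def by (rule sum.cong) (use that in \<open>auto simp: A_def\<close>)
      with fI that show ?thesis by (simp add: I_def)
    qed
    \<comment> \<open>K bounds both S and all its approximants, so that functions which are
      Lipschitz only on [-K, K], such as squares, can be composed with them.\<close>
    define K where "K = (\<Sum>i\<in>I. \<bar>i\<bar>)"
    have "\<forall>i k. \<exists>B\<in>\<A>. measure P (sym_diff (A i) B) < 1 / (real k + 1) \<and> measure Q (sym_diff (A i) B) < 1 / (real k + 1)"
      by (intro allI approx A) simp
    then obtain B where B: "\<And>i k. B i k \<in> \<A>"
      "\<And>i k. measure P (sym_diff (A i) (B i k)) < 1 / (real k + 1)"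
      "\<And>i k. measure Q (sym_diff (A i) (B i k)) < 1 / (real k + 1)" by metis
    have Bm: "B i k \<in> sets P" for i k using B sub by auto
    define U where "U = (\<lambda>k x. \<Sum>i\<in>I. i * indicator (B i k) x)"
    have [measurable]: "S \<in> borel_measurable P" "U k \<in> borel_measurable P" for k
      unfolding S_def U_def using A Bm by measurable
    have bd: "\<bar>S x\<bar> \<le> K" "\<bar>U k x\<bar> \<le> K" for x k
      unfolding S_def U_def K_def
      by (rule order_trans[OF sum_abs] sum_mono; auto simp: indicator_def)+
    \<comment> \<open>The pointwise error is at most D times the weighted sum of the indicators of
      the symmetric differences, so the expectations differ by at most D K / (k + 1). This is stated
      for a general measure R and function g because it serves the means under both laws as well as
      the second moment around m.\<close>
    have lim: "(\<lambda>k. \<integral>x. g (U k x) \<partial>R) \<longlonglongrightarrow> (\<integral>x. g (S x) \<partial>R)"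
      if "prob_space R" and [measurable_cong]: "sets R = sets P"
        and lt: "\<And>i k. measure R (sym_diff (A i) (B i k)) < 1 / (real k + 1)"
        and [measurable]: "g \<in> borel_measurable borel"
        and lip: "\<And>a b. \<bar>a\<bar> \<le> K \<Longrightarrow> \<bar>b\<bar> \<le> K \<Longrightarrow> \<bar>g a - g b\<bar> \<le> D * \<bar>a - b\<bar>" and "0 \<le> D"
        and gb: "\<And>a. \<bar>a\<bar> \<le> K \<Longrightarrow> \<bar>g a\<bar> \<le> E" for R g D E
    proof -
      interpret R: prob_space R by fact
      have [measurable]: "sym_diff (A i) (B i k) \<in> sets R" for i k using that A Bm by auto
      have iU: "integrable R (\<lambda>x. g (U k x))" for k
        by (rule R.integrable_const_bound[of _ E]) (use gb bd in auto)
      have iS: "integrable R (\<lambda>x. g (S x))"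
        by (rule R.integrable_const_bound[of _ E]) (use gb bd in auto)
      have ind: "integrable R (indicat_real (sym_diff (A i) (B i k)))" for i k
        by (rule integrable_real_indicator) (auto simp: R.emeasure_eq_measure)
      have bound: "\<bar>(\<integral>x. g (U k x) \<partial>R) - (\<integral>x. g (S x) \<partial>R)\<bar> \<le> D * K * (1 / (real k + 1))" for k
      proof -
        have pw: "\<bar>g (U k x) - g (S x)\<bar> \<le> D * (\<Sum>i\<in>I. \<bar>i\<bar> * indicator (sym_diff (A i) (B i k)) x)" for x
        proof -
          have "\<bar>U k x - S x\<bar> = \<bar>\<Sum>i\<in>I. i * (indicator (B i k) x - indicator (A i) x)\<bar>"
            by (simp add: U_def S_def sum_subtractf right_diff_distrib)
          also have "\<dots> \<le> (\<Sum>i\<in>I. \<bar>i\<bar> * indicator (sym_diff (A i) (B i k)) x)"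
            by (rule order_trans[OF sum_abs]) (auto intro!: sum_mono simp: indicator_def abs_mult)
          finally show ?thesis
            using lip[OF bd(2) bd(1), of k x x] \<open>0 \<le> D\<close> by (meson mult_left_mono order_trans)
        qed
        have "\<bar>(\<integral>x. g (U k x) \<partial>R) - (\<integral>x. g (S x) \<partial>R)\<bar> = \<bar>\<integral>x. g (U k x) - g (S x) \<partial>R\<bar>"
          using iU iS by simp
        also have "\<dots> \<le> (\<integral>x. \<bar>g (U k x) - g (S x)\<bar> \<partial>R)" by (rule integral_abs_bound)
        also have "\<dots> \<le> (\<integral>x. D * (\<Sum>i\<in>I. \<bar>i\<bar> * indicator (sym_diff (A i) (B i k)) x) \<partial>R)"
        proof (rule integral_mono)
          show "integrable R (\<lambda>x. D * (\<Sum>i\<in>I. \<bar>i\<bar> * indicator (sym_diff (A i) (B i k)) x))"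
            by (intro integrable_mult_right Bochner_Integration.integrable_sum ind)
        qed (use iU iS pw in auto)
        also have "\<dots> = D * (\<Sum>i\<in>I. \<bar>i\<bar> * measure R (sym_diff (A i) (B i k)))"
        proof -
          have "sym_diff (A i) (B i k) \<inter> space R = sym_diff (A i) (B i k)" for i
            using sets.sets_into_space[of "sym_diff (A i) (B i k)" R] by auto
          then have "(\<integral>x. \<bar>i\<bar> * indicator (sym_diff (A i) (B i k)) x \<partial>R) = \<bar>i\<bar> * measure R (sym_diff (A i) (B i k))" for i
            by simp
          moreover have "(\<integral>x. (\<Sum>i\<in>I. \<bar>i\<bar> * indicator (sym_diff (A i) (B i k)) x) \<partial>R)
              = (\<Sum>i\<in>I. \<integral>x. \<bar>i\<bar> * indicator (sym_diff (A i) (B i k)) x \<partial>R)"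
            by (rule Bochner_Integration.integral_sum) (intro integrable_mult_right ind)
          ultimately show ?thesis by (simp only: integral_mult_right_zero)
        qed
        also have "\<dots> \<le> D * (\<Sum>i\<in>I. \<bar>i\<bar> * (1 / (real k + 1)))"
          by (intro mult_left_mono sum_mono less_imp_le[OF lt] \<open>0 \<le> D\<close>) auto
        also have "\<dots> = D * K * (1 / (real k + 1))" by (simp only: K_def sum_distrib_right mult.assoc)
        finally show ?thesis .
      qed
      have "(\<lambda>k. D * K * (1 / (real k + 1))) \<longlonglongrightarrow> D * K * 0"
        using LIMSEQ_inverse_real_of_nat by (intro tendsto_intros) (simp add: inverse_eq_divide add.commute)
      then have lim0: "(\<lambda>k. D * K * (1 / (real k + 1))) \<longlonglongrightarrow> 0" by simp
      have "(\<lambda>k. (\<integral>x. g (U k x) \<partial>R) - (\<integral>x. g (S x) \<partial>R)) \<longlonglongrightarrow> 0"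
        by (rule Lim_null_comparison[OF always_eventually lim0]) (use bound in \<open>simp only: real_norm_def simp_thms\<close>)
      then show ?thesis by (simp add: LIM_zero_iff)
    qed
    have limQ: "(\<lambda>k. \<integral>x. U k x \<partial>Q) \<longlonglongrightarrow> (\<integral>x. S x \<partial>Q)"
      by (rule lim[of _ "\<lambda>x. x" 1 K]) (use Q sets_eq B(3) in auto)
    have limP: "(\<lambda>k. \<integral>x. U k x \<partial>P) \<longlonglongrightarrow> (\<integral>x. S x \<partial>P)"
      by (rule lim[of _ "\<lambda>x. x" 1 K]) (use P B(2) in auto)
    have limV: "(\<lambda>k. \<integral>x. (U k x - m)\<^sup>2 \<partial>P) \<longlonglongrightarrow> (\<integral>x. (S x - m)\<^sup>2 \<partial>P)"
    \<comment> \<open>On [-K, K] the function (x - m)^2 has Lipschitz constant 2K + 2|m|, by the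
      factorisation (a + b - 2m)(a - b).\<close>
    proof (rule lim[of _ "\<lambda>x. (x - m)\<^sup>2" "2 * K + 2 * \<bar>m\<bar>" "(K + \<bar>m\<bar>)\<^sup>2"])
      fix a b assume ab: "\<bar>a\<bar> \<le> K" "\<bar>b\<bar> \<le> K"
      have "(a - m)\<^sup>2 - (b - m)\<^sup>2 = (a + b - 2 * m) * (a - b)"
        by (simp add: power2_eq_square algebra_simps)
      moreover have "\<bar>a + b - 2 * m\<bar> \<le> 2 * K + 2 * \<bar>m\<bar>" using ab by linarith
      ultimately show "\<bar>(a - m)\<^sup>2 - (b - m)\<^sup>2\<bar> \<le> (2 * K + 2 * \<bar>m\<bar>) * \<bar>a - b\<bar>"
        by (simp add: abs_mult mult_right_mono)
    next
      fix a assume "\<bar>a\<bar> \<le> K"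
      then have "\<bar>a - m\<bar> \<le> K + \<bar>m\<bar>" by linarith
      then show "\<bar>(a - m)\<^sup>2\<bar> \<le> (K + \<bar>m\<bar>)\<^sup>2" by (metis abs_ge_zero power2_abs power_mono abs_power2)
    qed (use P B(2) in \<open>auto simp: K_def sum_nonneg\<close>)
    have "((\<integral>x. S x \<partial>Q) - (\<integral>x. S x \<partial>P))\<^sup>2 \<le> c * (\<integral>x. (S x - m)\<^sup>2 \<partial>P)"
    proof (rule LIMSEQ_le)
      show "(\<lambda>k. ((\<integral>x. U k x \<partial>Q) - (\<integral>x. U k x \<partial>P))\<^sup>2) \<longlonglongrightarrow> ((\<integral>x. S x \<partial>Q) - (\<integral>x. S x \<partial>P))\<^sup>2"
        by (intro tendsto_intros limQ limP)
      show "(\<lambda>k. c * (\<integral>x. (U k x - m)\<^sup>2 \<partial>P)) \<longlonglongrightarrow> c * (\<integral>x. (S x - m)\<^sup>2 \<partial>P)"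
        by (intro tendsto_intros limV)
      show "\<exists>k0. \<forall>k\<ge>k0. ((\<integral>x. U k x \<partial>Q) - (\<integral>x. U k x \<partial>P))\<^sup>2 \<le> c * (\<integral>x. (U k x - m)\<^sup>2 \<partial>P)"
        unfolding U_def by (intro exI allI impI simple[OF fI] B(1))
    qed
    moreover have "(\<integral>x. s x \<partial>Q) = (\<integral>x. S x \<partial>Q)"
      using sets_eq_imp_space_eq[OF sets_eq] by (intro Bochner_Integration.integral_cong) (auto simp: s_eq)
    moreover have "(\<integral>x. s x \<partial>P) = (\<integral>x. S x \<partial>P)" "(\<integral>x. (s x - m)\<^sup>2 \<partial>P) = (\<integral>x. (S x - m)\<^sup>2 \<partial>P)"
      by (intro Bochner_Integration.integral_cong; simp add: s_eq)+
    ultimately show ?thesis by simp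
  qed
  obtain s where s': "\<forall>j. simple_function P (s j)" "\<forall>x\<in>space P. (\<lambda>j. s j x) \<longlonglongrightarrow> T x"
    "\<forall>j. \<forall>x\<in>space P. dist (s j x) 0 \<le> 2 * dist (T x) 0"
    using borel_measurable_implies_sequence_metric[OF T, of 0] by blast
  then have s: "\<And>j. simple_function P (s j)" "\<And>x. x \<in> space P \<Longrightarrow> (\<lambda>j. s j x) \<longlonglongrightarrow> T x"
    "\<And>j x. x \<in> space P \<Longrightarrow> \<bar>s j x\<bar> \<le> 2 * \<bar>T x\<bar>"
    by (simp_all add: dist_real_def)
  have [measurable]: "s j \<in> borel_measurable P" for j using s(1) by (rule borel_measurable_simple_function)
  have iT: "integrable P T"
    by (rule P.square_integrable_imp_integrable) (use TP in auto)
  have spQ: "space Q = space P" using sets_eq by (rule sets_eq_imp_space_eq)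
  show ?thesis
  proof (rule LIMSEQ_le)
    have "(\<lambda>j. \<integral>x. s j x \<partial>Q) \<longlonglongrightarrow> (\<integral>x. T x \<partial>Q)"
      by (rule integral_dominated_convergence[where w="\<lambda>x. 2 * \<bar>T x\<bar>"])
         (use TQ s spQ in \<open>auto intro!: AE_I2\<close>)
    moreover have "(\<lambda>j. \<integral>x. s j x \<partial>P) \<longlonglongrightarrow> (\<integral>x. T x \<partial>P)"
      by (rule integral_dominated_convergence[where w="\<lambda>x. 2 * \<bar>T x\<bar>"])
         (use iT s in \<open>auto intro!: AE_I2\<close>)
    ultimately show "(\<lambda>j. ((\<integral>x. s j x \<partial>Q) - (\<integral>x. s j x \<partial>P))\<^sup>2) \<longlonglongrightarrow> ((\<integral>x. T x \<partial>Q) - (\<integral>x. T x \<partial>P))\<^sup>2"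
      by (intro tendsto_intros)
    have "(\<lambda>j. \<integral>x. (s j x - m)\<^sup>2 \<partial>P) \<longlonglongrightarrow> (\<integral>x. (T x - m)\<^sup>2 \<partial>P)"
    \<comment> \<open>The dominating function comes from (s - m)^2 \<le> 2 s^2 + 2 m^2 together with
      |s| \<le> 2|T|.\<close>
    proof (rule integral_dominated_convergence[where w="\<lambda>x. 8 * (T x)\<^sup>2 + 2 * m\<^sup>2"])
      show "integrable P (\<lambda>x. 8 * (T x)\<^sup>2 + 2 * m\<^sup>2)" using TP by simp
      fix j
      show "AE x in P. norm ((s j x - m)\<^sup>2) \<le> 8 * (T x)\<^sup>2 + 2 * m\<^sup>2"
      proof (rule AE_I2)
        fix x assume "x \<in> space P"
        then have "(s j x)\<^sup>2 \<le> (2 * \<bar>T x\<bar>)\<^sup>2"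
          using s(3)[of x j] by (metis abs_ge_zero power2_abs power_mono)
        then have "(s j x)\<^sup>2 \<le> 4 * (T x)\<^sup>2" by (simp add: power_mult_distrib)
        moreover have "(s j x - m)\<^sup>2 + (s j x + m)\<^sup>2 = 2 * (s j x)\<^sup>2 + 2 * m\<^sup>2"
          by (simp add: power2_eq_square algebra_simps)
        moreover have "0 \<le> (s j x + m)\<^sup>2" by simp
        ultimately have "(s j x - m)\<^sup>2 \<le> 8 * (T x)\<^sup>2 + 2 * m\<^sup>2"
          by linarith
        then show "norm ((s j x - m)\<^sup>2) \<le> 8 * (T x)\<^sup>2 + 2 * m\<^sup>2" by simp
      qed
    qed (use s in \<open>auto intro!: AE_I2 tendsto_intros\<close>)
    then show "(\<lambda>j. c * (\<integral>x. (s j x - m)\<^sup>2 \<partial>P)) \<longlonglongrightarrow> c * (\<integral>x. (T x - m)\<^sup>2 \<partial>P)"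
      by (intro tendsto_intros)
    show "\<exists>j0. \<forall>j\<ge>j0. ((\<integral>x. s j x \<partial>Q) - (\<integral>x. s j x \<partial>P))\<^sup>2 \<le> c * (\<integral>x. (s j x - m)\<^sup>2 \<partial>P)"
      using S s(1) by blast
  qed
qed

section \<open>The white noise model\<close>

text \<open>Increments are taken instead of values because they are independent under the white
  noise law. Restriction to the index set makes the result an element of a product space.\<close>

definition increments :: "nat \<Rightarrow> (real \<Rightarrow> real) \<Rightarrow> nat \<Rightarrow> real" where
  "increments k y = (\<lambda>i\<in>{..<2 ^ k}. y (real (Suc i) / 2 ^ k) - y (real i / 2 ^ k))"

lemma dyadic_in_unit: "i \<le> 2 ^ k \<Longrightarrow> real i / 2 ^ k \<in> {0..1}"
  by (simp add: divide_le_eq numeral_power_le_of_nat_cancel_iff)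

lemma space_path_space: "space path_space = {y \<in> extensional {0..1}. continuous_on {0..1} y}"
  by (auto simp: path_space_def space_restrict_space space_PiM PiE_def)

lemma measurable_path_space_eval [measurable]:
  "t \<in> {0..1} \<Longrightarrow> (\<lambda>y. y t) \<in> borel_measurable path_space"
  unfolding path_space_def by (intro measurable_restrict_space1 measurable_component_singleton)

lemma measurable_into_path_space:
  assumes "\<And>t. t \<in> {0..1} \<Longrightarrow> (\<lambda>x. h x t) \<in> borel_measurable N"
    and "\<And>x. x \<in> space N \<Longrightarrow> h x \<in> space path_space"
  shows "h \<in> measurable N path_space"
  unfolding path_space_def
proof (rule measurable_restrict_space2)
  show "h \<in> space N \<rightarrow> {y. continuous_on {0..1} y}"
    using assms(2) by (auto simp: space_path_space)
  show "h \<in> measurable N (Pi\<^sub>M {0..1} (\<lambda>_. borel))"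
    using assms by (intro measurable_PiM_single') (auto simp: space_path_space PiE_def)
qed

lemma measurable_increments [measurable]:
  "increments k \<in> measurable path_space (PiM {..<2 ^ k} (\<lambda>_. borel))"
  unfolding increments_def
  by (intro measurable_restrict borel_measurable_diff measurable_path_space_eval dyadic_in_unit) auto

lemma measurable_white_noise_obs:
  assumes "std_brownian_motion M W" "continuous_on {0..1} f"
  shows "white_noise_obs W n f \<in> measurable M path_space"
proof (rule measurable_into_path_space)
  fix t :: real assume t: "t \<in> {0..1}"
  then have [measurable]: "W t \<in> borel_measurable M"
    using assms by (auto simp: std_brownian_motion_def)
  show "(\<lambda>\<omega>. white_noise_obs W n f \<omega> t) \<in> borel_measurable M"
    using t by (simp add: white_noise_obs_def)
next
  fix \<omega> assume "\<omega> \<in> space M"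
  then have W: "continuous_on {0..1} (\<lambda>t. W t \<omega>)"
    using assms by (auto simp: std_brownian_motion_def)
  have "f integrable_on {0..1}" using assms(2) by (rule integrable_continuous_interval)
  then have "continuous_on {0..1} (\<lambda>x. integral {0..x} f)"
    by (rule indefinite_integral_continuous_1)
  with W have "continuous_on {0..1} (\<lambda>x. integral {0..x} f + real n powr (- 1 / 2) * W x \<omega>)"
    by (intro continuous_intros)
  then have "continuous_on {0..1} (white_noise_obs W n f \<omega>)"
    by (rule continuous_on_eq) (simp add: white_noise_obs_def)
  then show "white_noise_obs W n f \<omega> \<in> space path_space"
    by (simp add: space_path_space white_noise_obs_def)
qed

lemma sets_white_noise_law [simp]: "sets (white_noise_law M W n f) = sets path_space"
  by (simp add: white_noise_law_def)

lemma space_white_noise_law [simp]: "space (white_noise_law M W n f) = space path_space"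
  by (simp add: white_noise_law_def)

lemma prob_space_white_noise_law:
  assumes "std_brownian_motion M W" "continuous_on {0..1} f"
  shows "prob_space (white_noise_law M W n f)"
  unfolding white_noise_law_def
  by (rule prob_space.prob_space_distr) (use assms measurable_white_noise_obs in \<open>auto simp: std_brownian_motion_def\<close>)

lemma AE_white_noise_law_starts_at_0:
  assumes "std_brownian_motion M W" "continuous_on {0..1} f"
  shows "AE y in white_noise_law M W n f. y 0 = 0"
proof -
  have [measurable]: "white_noise_obs W n f \<in> measurable M path_space"
    by (rule measurable_white_noise_obs) fact+
  have [measurable]: "(\<lambda>y. y 0) \<in> borel_measurable path_space" by (rule measurable_path_space_eval) simp
  show ?thesis unfolding white_noise_law_def
    by (subst AE_distr_iff) (use assms(1) in \<open>auto simp: white_noise_obs_def std_brownian_motion_def intro!: AE_I2\<close>)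
qed

text \<open>The drift enters only through the means; the increments are independent with common
  variance 1 / (n 2^k). Two drifts thus lead to two Gaussian products of the kind compared in
  \<open>chi_square_bound_normal\<close>.\<close>

lemma distr_increments_white_noise_law:
  assumes bm: "std_brownian_motion M W" and f: "continuous_on {0..1} f" and n: "n \<ge> 1"
  shows "distr (white_noise_law M W n f) (PiM {..<2 ^ k} (\<lambda>_. borel)) (increments k)
    = PiM {..<2 ^ k} (\<lambda>i. density lborel (normal_density (integral {real i / 2 ^ k..real (Suc i) / 2 ^ k} f)
        (1 / sqrt (real n * 2 ^ k))))"
proof -
  interpret prob_space M using bm by (simp add: std_brownian_motion_def)
  define a where "a = (\<lambda>i. integral {real i / 2 ^ k..real (Suc i) / 2 ^ k} f)"
  define \<sigma> where "\<sigma> = 1 / sqrt (real n * 2 ^ k)"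
  define D where "D = (\<lambda>i \<omega>. W (real (Suc i) / 2 ^ k) \<omega> - W (real i / 2 ^ k) \<omega>)"
  define X where "X = (\<lambda>i \<omega>. a i + real n powr (- 1 / 2) * D i \<omega>)"
  have [measurable]: "white_noise_obs W n f \<in> measurable M path_space"
    by (rule measurable_white_noise_obs) fact+
  have X_eq: "increments k (white_noise_obs W n f \<omega>) = (\<lambda>i\<in>{..<2 ^ k}. X i \<omega>)" for \<omega>
  proof -
    have "integral {0..real (Suc i) / 2 ^ k} f - integral {0..real i / 2 ^ k} f = a i" if "i < 2 ^ k" for i
    proof -
      have le: "real i / 2 ^ k \<le> real (Suc i) / 2 ^ k" by (simp add: divide_right_mono)
      have "f integrable_on {0..real (Suc i) / 2 ^ k}"
        using f dyadic_in_unit[of "Suc i" k] that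
        by (intro integrable_continuous_interval continuous_on_subset[OF f]) auto
      from Henstock_Kurzweil_Integration.integral_combine[OF _ le this]
      show ?thesis by (simp add: a_def)
    qed
    then show ?thesis
      using dyadic_in_unit[of _ k]
      by (auto simp: increments_def white_noise_obs_def X_def D_def fun_eq_iff algebra_simps simp del: of_nat_Suc)
  qed
  have dD: "distributed M lborel (D i) (normal_density 0 (sqrt (1 / 2 ^ k)))" if "i < 2 ^ k" for i
  proof -
    have "real (Suc i) / 2 ^ k - real i / 2 ^ k = 1 / 2 ^ k" by (simp add: field_simps)
    moreover have "real i / 2 ^ k < real (Suc i) / 2 ^ k" by (simp add: divide_strict_right_mono)
    moreover have "real (Suc i) / 2 ^ k \<le> 1" using dyadic_in_unit[of "Suc i" k] that by auto
    ultimately show ?thesis using bm unfolding std_brownian_motion_def D_def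
      by (metis divide_nonneg_pos of_nat_0_le_iff zero_less_numeral zero_less_power)
  qed
  have dX: "distributed M lborel (X i) (normal_density (a i) \<sigma>)" if "i < 2 ^ k" for i
  proof -
    have "distributed M lborel (X i)
        (normal_density (a i + real n powr (- 1 / 2) * 0) (\<bar>real n powr (- 1 / 2)\<bar> * sqrt (1 / 2 ^ k)))"
      unfolding X_def by (rule normal_density_affine[OF dD[OF that]]) (use n in auto)
    moreover have "\<bar>real n powr (- 1 / 2)\<bar> * sqrt (1 / 2 ^ k) = \<sigma>"
      using n by (simp add: \<sigma>_def powr_minus powr_half_sqrt real_sqrt_mult real_sqrt_divide field_simps)
    ultimately show ?thesis by simp
  qed
  have [measurable]: "X i \<in> borel_measurable M" if "i < 2 ^ k" for i
    using distributed_measurable[OF dX[OF that]] by simp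
  have "indep_vars (\<lambda>_. borel) D {..<2 ^ k}"
  proof -
    have "real i / 2 ^ k < real (Suc i) / 2 ^ k" for i by (simp add: divide_strict_right_mono)
    then show ?thesis unfolding D_def
      using bm[unfolded std_brownian_motion_def, THEN conjunct2, THEN conjunct2, THEN conjunct2, THEN conjunct2, THEN conjunct2,
          rule_format, of "\<lambda>i. real i / 2 ^ k" "2 ^ k"]
      by simp
  qed
  then have "indep_vars (\<lambda>_. borel) X {..<2 ^ k}"
    unfolding X_def by (rule indep_vars_compose2) measurable
  then have "distr M (PiM {..<2 ^ k} (\<lambda>_. borel)) (\<lambda>\<omega>. \<lambda>i\<in>{..<2 ^ k}. X i \<omega>)
      = PiM {..<2 ^ k} (\<lambda>i. distr M borel (X i))"
    by (subst (asm) indep_vars_iff_distr_eq_PiM') (auto simp: lessThan_empty_iff)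
  also have "\<dots> = PiM {..<2 ^ k} (\<lambda>i. density lborel (normal_density (a i) \<sigma>))"
  proof (rule PiM_cong)
    fix i :: nat assume "i \<in> {..<2 ^ k}"
    then have "distr M lborel (X i) = density lborel (normal_density (a i) \<sigma>)"
      using dX distributed_distr_eq_density by blast
    moreover have "distr M borel (X i) = distr M lborel (X i)" by (rule distr_cong) auto
    ultimately show "distr M borel (X i) = density lborel (normal_density (a i) \<sigma>)" by simp
  qed simp
  finally show ?thesis
    unfolding white_noise_law_def a_def \<sigma>_def
    by (subst distr_distr) (auto simp: comp_def X_eq)
qed

section \<open>The algebra of dyadic cylinders\<close>

text \<open>An increment of level k is the sum of the two increments of level k + 1 with indices 2i
  and 2i + 1, so a cylinder of one level is a cylinder of every finer level.\<close>

lemma increments_cylinder_mono: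
  assumes "k \<le> l" and B: "B \<in> sets (PiM {..<2 ^ k} (\<lambda>_. borel))"
  shows "\<exists>B'\<in>sets (PiM {..<2 ^ l} (\<lambda>_. borel)).
    increments k -` B \<inter> space path_space = increments l -` B' \<inter> space path_space"
  using assms
proof (induction arbitrary: B rule: inc_induct)
  case base
  then show ?case by blast
next
  case (step k)
  define h where "h = (\<lambda>(x :: nat \<Rightarrow> real). \<lambda>i\<in>{..<2 ^ k}. x (2 * i) + x (2 * i + 1))"
  have [measurable]: "h \<in> measurable (PiM {..<2 ^ Suc k} (\<lambda>_. borel)) (PiM {..<2 ^ k} (\<lambda>_. borel))"
    unfolding h_def by (intro measurable_restrict borel_measurable_add measurable_component_singleton) auto
  have h: "increments k y = h (increments (Suc k) y)" for y
  proof
    fix i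
    have "real (Suc (2 * i + 1)) / 2 ^ Suc k = real (Suc i) / 2 ^ k" "real (2 * i) / 2 ^ Suc k = real i / 2 ^ k"
      by (simp_all add: field_simps)
    then show "increments k y i = h (increments (Suc k) y) i"
      by (simp add: increments_def h_def del: power_Suc of_nat_Suc) simp
  qed
  define B'' where "B'' = h -` B \<inter> space (PiM {..<2 ^ Suc k} (\<lambda>_. borel :: real measure))"
  have "B'' \<in> sets (PiM {..<2 ^ Suc k} (\<lambda>_. borel))"
    unfolding B''_def using step.prems by measurable
  moreover have "increments k -` B \<inter> space path_space = increments (Suc k) -` B'' \<inter> space path_space"
    using measurable_space[OF measurable_increments, of _ "Suc k"] by (auto simp: B''_def h)
  ultimately show ?case using step.IH[of B''] by simp
qed

text \<open>Increments do not see \<open>y 0\<close>, so these sets generate the \<open>\<sigma>\<close>-algebra of \<^const>\<open>path_space\<close> only up to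
  null sets of laws under which \<open>y 0 = 0\<close> almost surely.\<close>

definition dyadic_cylinders :: "(real \<Rightarrow> real) set set" where
  "dyadic_cylinders = {increments k -` B \<inter> space path_space |k B. B \<in> sets (PiM {..<2 ^ k} (\<lambda>_. borel))}"

lemma dyadic_cylinders_sets: "dyadic_cylinders \<subseteq> sets path_space"
  unfolding dyadic_cylinders_def using measurable_sets[OF measurable_increments] by blast

lemma dyadic_cylindersI:
  "B \<in> sets (PiM {..<2 ^ k} (\<lambda>_. borel)) \<Longrightarrow> increments k -` B \<inter> space path_space \<in> dyadic_cylinders"
  unfolding dyadic_cylinders_def by blast

text \<open>Refinement to the largest level occurring brings finitely many cylinders to a common
  level. A simple function over cylinders is then a function of a single Gaussian vector.\<close>

lemma finite_dyadic_cylinders: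
  assumes "finite I" "\<And>i. i \<in> I \<Longrightarrow> A i \<in> dyadic_cylinders"
  shows "\<exists>k B. \<forall>i\<in>I. B i \<in> sets (PiM {..<2 ^ k} (\<lambda>_. borel)) \<and> A i = increments k -` B i \<inter> space path_space"
proof -
  have "\<forall>i\<in>I. \<exists>k. \<exists>B\<in>sets (PiM {..<2 ^ k} (\<lambda>_. borel)). A i = increments k -` B \<inter> space path_space"
  proof
    fix i assume "i \<in> I"
    from assms(2)[OF this]
    show "\<exists>k. \<exists>B\<in>sets (PiM {..<2 ^ k} (\<lambda>_. borel)). A i = increments k -` B \<inter> space path_space"
      unfolding dyadic_cylinders_def by blast
  qed
  from bchoice[OF this] obtain k where k: "\<forall>i\<in>I. \<exists>B\<in>sets (PiM {..<2 ^ k i} (\<lambda>_. borel)).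
      A i = increments (k i) -` B \<inter> space path_space" ..
  \<comment> \<open>The inserted 0 keeps the maximum defined when the index set is empty.\<close>
  define l where "l = Max (insert 0 (k ` I))"
  have "\<forall>i\<in>I. \<exists>B. B \<in> sets (PiM {..<2 ^ l} (\<lambda>_. borel)) \<and> A i = increments l -` B \<inter> space path_space"
  proof
    fix i assume i: "i \<in> I"
    have "k i \<le> l" using i assms(1) by (simp add: l_def)
    moreover obtain B where "B \<in> sets (PiM {..<2 ^ k i} (\<lambda>_. borel))" "A i = increments (k i) -` B \<inter> space path_space"
      using k i by blast
    ultimately show "\<exists>B. B \<in> sets (PiM {..<2 ^ l} (\<lambda>_. borel)) \<and> A i = increments l -` B \<inter> space path_space"
      using increments_cylinder_mono[of "k i" l B] by auto
  qed
  from bchoice[OF this] show ?thesis by blast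
qed

lemma dyadic_cylinders_Un:
  assumes "A \<in> dyadic_cylinders" "B \<in> dyadic_cylinders"
  shows "A \<union> B \<in> dyadic_cylinders"
proof -
  \<comment> \<open>The two sets are treated as a family indexed by \<open>bool\<close>, which
    yields one level for both.\<close>
  have "\<exists>k C. \<forall>i\<in>UNIV. C i \<in> sets (PiM {..<2 ^ k} (\<lambda>_. borel)) \<and>
      (if i then A else B) = increments k -` C i \<inter> space path_space"
    by (rule finite_dyadic_cylinders) (use assms in auto)
  then obtain k C where C: "\<forall>i\<in>UNIV. C i \<in> sets (PiM {..<2 ^ k} (\<lambda>_. borel)) \<and>
      (if i then A else B) = increments k -` C i \<inter> space path_space"
    by (elim exE)
  have CT: "C True \<in> sets (PiM {..<2 ^ k} (\<lambda>_. borel))" "A = increments k -` C True \<inter> space path_space"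
    using C[rule_format, of True] by simp_all
  have CF: "C False \<in> sets (PiM {..<2 ^ k} (\<lambda>_. borel))" "B = increments k -` C False \<inter> space path_space"
    using C[rule_format, of False] by simp_all
  have "A \<union> B = increments k -` (C True \<union> C False) \<inter> space path_space"
    using CT(2) CF(2) by blast
  with CT(1) CF(1) show ?thesis using dyadic_cylindersI[of "C True \<union> C False" k] by auto
qed

lemma dyadic_cylinders_Compl:
  assumes "A \<in> dyadic_cylinders"
  shows "space path_space - A \<in> dyadic_cylinders"
proof -
  obtain k B where B: "B \<in> sets (PiM {..<2 ^ k} (\<lambda>_. borel))" "A = increments k -` B \<inter> space path_space"
    using assms unfolding dyadic_cylinders_def by blast
  have "space path_space - A = increments k -` (space (PiM {..<2 ^ k} (\<lambda>_. borel)) - B) \<inter> space path_space"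
    using B(2) measurable_space[OF measurable_increments, of _ k] by auto
  with B(1) show ?thesis
    using dyadic_cylindersI[of "space (PiM {..<2 ^ k} (\<lambda>_. borel)) - B" k] by auto
qed

text \<open>The approximable sets form a sigma-algebra \<S>, so it is enough that every evaluation y
  t is measurable with respect to \<S>. At a dyadic time it agrees almost surely with a sum of
  increments, because y 0 = 0 almost surely; at other times continuity of the paths makes it a limit
  of evaluations at dyadic times.\<close>

lemma dyadic_cylinders_approximate:
  assumes P: "finite_measure P" "sets P = sets path_space" and P0: "AE y in P. y 0 = 0"
    and Q: "finite_measure Q" "sets Q = sets path_space" and Q0: "AE y in Q. y 0 = 0"
    and A: "A \<in> sets path_space" and "\<epsilon> > 0"
  shows "\<exists>B\<in>dyadic_cylinders. measure P (sym_diff A B) + measure Q (sym_diff A B) < \<epsilon>"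
proof -
  define \<S> where "\<S> = {A \<in> sets P. \<forall>\<epsilon>>0. \<exists>B\<in>dyadic_cylinders.
    measure P (sym_diff A B) + measure Q (sym_diff A B) < \<epsilon>}"
  have spP: "space P = space path_space" using P(2) by (rule sets_eq_imp_space_eq)
  have "sigma_algebra (space P) \<S>"
    unfolding \<S>_def
  proof (rule sigma_algebra_approximable)
    show "dyadic_cylinders \<subseteq> sets P" using dyadic_cylinders_sets P(2) by simp
    show "{} \<in> dyadic_cylinders" using dyadic_cylindersI[of "{}" 0] by simp
    show "space P - A \<in> dyadic_cylinders" if "A \<in> dyadic_cylinders" for A
      unfolding spP by (rule dyadic_cylinders_Compl) fact
  qed (simp_all add: P Q dyadic_cylinders_Un)
  then interpret \<S>: sigma_algebra "space P" \<S> .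
  \<comment> \<open>Only the sigma-algebra of N matters; its measure is a dummy.\<close>
  define N where "N = measure_of (space P) \<S> (\<lambda>_. 0)"
  have setsN: "sets N = \<S>" and spN: "space N = space path_space"
    by (simp_all add: N_def spP[symmetric] \<S>.sets_measure_of_eq \<S>.space_measure_of_eq)
  have dyadic: "(\<lambda>y. y (real j / 2 ^ k)) \<in> borel_measurable N" if j: "j \<le> 2 ^ k" for j k
  proof (rule measurableI)
    fix C :: "real set" assume C: "C \<in> sets borel"
    have t: "real j / 2 ^ k \<in> {0..1}" using j by (rule dyadic_in_unit)
    define E where "E = (\<lambda>y :: real \<Rightarrow> real. y (real j / 2 ^ k)) -` C \<inter> space path_space"
    define S where "S = (\<lambda>x :: nat \<Rightarrow> real. \<Sum>i<j. x i)"
    have Sm: "S \<in> borel_measurable (PiM {..<2 ^ k} (\<lambda>_. borel))"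
      unfolding S_def using j by (intro borel_measurable_sum measurable_component_singleton) auto
    define B where "B = S -` C \<inter> space (PiM {..<2 ^ k} (\<lambda>_. borel :: real measure))"
    have Bm: "B \<in> sets (PiM {..<2 ^ k} (\<lambda>_. borel))"
      unfolding B_def using Sm C by (rule measurable_sets)
    \<comment> \<open>The telescoping sum misses y at time j / 2^k by exactly y 0. The event E and
      the cylinder F therefore differ only on a null set of both laws.\<close>
    have tele: "S (increments k y) = y (real j / 2 ^ k) - y 0" for y
      using sum_lessThan_telescope[of "\<lambda>i. y (real i / 2 ^ k)" j] j
      by (auto simp: S_def increments_def intro!: sum.cong[THEN trans])
    define F where "F = increments k -` B \<inter> space path_space"
    have Em: "E \<in> sets path_space"
      unfolding E_def using measurable_path_space_eval[OF t] C by (rule measurable_sets)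
    have Fm: "F \<in> sets path_space"
      unfolding F_def using measurable_increments Bm by (rule measurable_sets)
    have iff: "y \<in> E \<longleftrightarrow> y \<in> F" if "y 0 = 0" for y
      using that tele[of y] measurable_space[OF measurable_increments, of y k]
      by (auto simp: E_def F_def B_def)
    have null: "measure R (sym_diff E F) = 0" if "AE y in R. y 0 = 0" "sets R = sets path_space" for R
    proof -
      have "sym_diff E F \<in> null_sets R"
        by (rule AE_iff_null_sets[THEN iffD2]) (use that Em Fm iff in auto)
      then show ?thesis by (simp add: measure_def null_setsD1)
    qed
    have "F \<in> dyadic_cylinders" unfolding F_def by (rule dyadic_cylindersI[OF Bm])
    moreover have "measure P (sym_diff E F) + measure Q (sym_diff E F) = 0"
      using null[OF P0 P(2)] null[OF Q0 Q(2)] by simp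
    ultimately have "E \<in> \<S>"
      unfolding \<S>_def using Em P(2) by (auto intro!: bexI[of _ F] simp del: Un_iff)
    then show "(\<lambda>y. y (real j / 2 ^ k)) -` C \<inter> space N \<in> sets N"
      by (simp add: setsN spN E_def)
  qed simp
  \<comment> \<open>Measurability of the identity says precisely that every measurable set of paths
    belongs to \<S>.\<close>
  have "(\<lambda>y. y) \<in> measurable N path_space"
  proof (rule measurable_into_path_space)
    fix t :: real assume t: "t \<in> {0..1}"
    define j where "j = (\<lambda>k. nat \<lfloor>t * 2 ^ k\<rfloor>)"
    have jle: "j k \<le> 2 ^ k" for k
    proof -
      have "\<lfloor>t * 2 ^ k\<rfloor> \<le> \<lfloor>2 ^ k :: real\<rfloor>" using t by (intro floor_mono) (simp add: mult_left_le_one_le)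
      also have "\<lfloor>2 ^ k :: real\<rfloor> = int (2 ^ k)" by (metis floor_of_nat of_nat_numeral of_nat_power)
      finally show ?thesis unfolding j_def by linarith
    qed
    have rj: "real (j k) = of_int \<lfloor>t * 2 ^ k\<rfloor>" for k
      unfolding j_def using t by (subst of_nat_nat) auto
    have conv: "(\<lambda>k. real (j k) / 2 ^ k) \<longlonglongrightarrow> t"
    proof (rule LIMSEQ_I)
      fix r :: real assume "r > 0"
      obtain k0 where k0: "(1/2 :: real) ^ k0 < r" using real_arch_pow_inv[OF \<open>r > 0\<close>, of "1/2"] by auto
      have "norm (real (j k) / 2 ^ k - t) < r" if "k0 \<le> k" for k
      proof -
        have "\<bar>real (j k) - t * 2 ^ k\<bar> \<le> 1" unfolding rj by linarith
        then have "\<bar>real (j k) - t * 2 ^ k\<bar> / 2 ^ k \<le> 1 / 2 ^ k" by (rule divide_right_mono) simp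
        also have "\<dots> \<le> (1/2) ^ k0" using power_decreasing[OF that, of "1/2 :: real"] by (simp add: power_divide)
        finally have "\<bar>real (j k) - t * 2 ^ k\<bar> / 2 ^ k < r" using k0 by simp
        moreover have "\<bar>real (j k) - t * 2 ^ k\<bar> / 2 ^ k = \<bar>(real (j k) - t * 2 ^ k) / 2 ^ k\<bar>"
          by (simp add: abs_divide)
        moreover have "(real (j k) - t * 2 ^ k) / 2 ^ k = real (j k) / 2 ^ k - t" by (simp add: field_simps)
        ultimately show ?thesis by simp
      qed
      then show "\<exists>k0. \<forall>k\<ge>k0. norm (real (j k) / 2 ^ k - t) < r" by blast
    qed
    show "(\<lambda>y. y t) \<in> borel_measurable N"
    proof (rule borel_measurable_LIMSEQ_real)
      show "(\<lambda>y. y (real (j k) / 2 ^ k)) \<in> borel_measurable N" for k by (rule dyadic[OF jle])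
      fix y assume "y \<in> space N"
      then have "continuous_on {0..1} y" by (simp add: spN space_path_space)
      then show "(\<lambda>k. y (real (j k) / 2 ^ k)) \<longlonglongrightarrow> y t"
        by (rule continuous_on_tendsto_compose) (use conv t dyadic_in_unit[OF jle] in auto)
    qed
  qed (simp add: spN)
  from measurable_sets[OF this A] have "A \<in> \<S>"
    using sets.sets_into_space[OF A] by (simp add: setsN spN Int_absorb2)
  with \<open>\<epsilon> > 0\<close> show ?thesis by (auto simp: \<S>_def)
qed

section \<open>The energy of a drift difference\<close>

text \<open>The integral of (g - m)^2 is nonnegative, where m is the mean of g over the interval;
  expanding the square gives the inequality.\<close>

lemma integral_square_le:
  fixes g :: "real \<Rightarrow> real"
  assumes g: "continuous_on {a..b} g" and "a \<le> b"
  shows "(integral {a..b} g)\<^sup>2 \<le> (b - a) * integral {a..b} (\<lambda>x. (g x)\<^sup>2)"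
proof (cases "a = b")
  case False
  define m where "m = integral {a..b} g / (b - a)"
  have ab: "a < b" using False \<open>a \<le> b\<close> by simp
  have ig: "g integrable_on {a..b}" "(\<lambda>x. (g x)\<^sup>2) integrable_on {a..b}"
    by (intro integrable_continuous_interval continuous_intros g)+
  have "0 \<le> integral {a..b} (\<lambda>x. (g x - m)\<^sup>2)"
    by (rule Henstock_Kurzweil_Integration.integral_nonneg)
       (auto intro!: integrable_continuous_interval continuous_intros g)
  also have "integral {a..b} (\<lambda>x. (g x - m)\<^sup>2) = integral {a..b} (\<lambda>x. (g x)\<^sup>2 + (- 2 * m) * g x + m\<^sup>2)"
    by (rule Henstock_Kurzweil_Integration.integral_cong) (simp add: power2_diff)
  also have "\<dots> = integral {a..b} (\<lambda>x. (g x)\<^sup>2) + (- 2 * m) * integral {a..b} g + (b - a) * m\<^sup>2"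
  proof -
    have "((\<lambda>x. (g x)\<^sup>2 + (- 2 * m) * g x + m\<^sup>2) has_integral
        integral {a..b} (\<lambda>x. (g x)\<^sup>2) + (- 2 * m) * integral {a..b} g + (b - a) * m\<^sup>2) {a..b}"
      using ab by (intro has_integral_add has_integral_mult_right integrable_integral ig)
        (use has_integral_const_real[of "m\<^sup>2" a b] in simp)
    then show ?thesis by (rule integral_unique)
  qed
  also have "integral {a..b} g = m * (b - a)" using ab by (simp add: m_def)
  finally have "m\<^sup>2 * (b - a) \<le> integral {a..b} (\<lambda>x. (g x)\<^sup>2)" by (simp add: power2_eq_square algebra_simps)
  then have "(b - a) * (m\<^sup>2 * (b - a)) \<le> (b - a) * integral {a..b} (\<lambda>x. (g x)\<^sup>2)"
    using ab by (intro mult_left_mono) auto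
  then show ?thesis using ab by (simp add: m_def power2_eq_square)
qed simp

lemma sum_integral_dyadic:
  fixes g :: "real \<Rightarrow> real"
  assumes g: "g integrable_on {0..1}" and "j \<le> 2 ^ k"
  shows "(\<Sum>i<j. integral {real i / 2 ^ k..real (Suc i) / 2 ^ k} g) = integral {0..real j / 2 ^ k} g"
  using \<open>j \<le> 2 ^ k\<close>
proof (induction j)
  case (Suc j)
  have "g integrable_on {0..real (Suc j) / 2 ^ k}"
    by (rule integrable_on_subinterval[OF g]) (use dyadic_in_unit[OF Suc.prems] in auto)
  from Henstock_Kurzweil_Integration.integral_combine[OF _ _ this, of "real j / 2 ^ k"]
  show ?case using Suc by (simp add: divide_right_mono)
qed simp

text \<open>For a simple function over cylinders of level k the bound holds with a discretised
  energy in the exponent. Jensen's inequality bounds this by the full energy whatever k is, so one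
  constant serves all cylinders and the bound extends to T.\<close>

proposition chi_square_bound_white_noise:
  assumes bm: "std_brownian_motion M W" and n: "n \<ge> 1"
    and f: "continuous_on {0..1} f" and g: "continuous_on {0..1} g"
    and T: "T \<in> borel_measurable path_space" and Tg: "integrable (white_noise_law M W n g) T"
    and Tf: "integrable (white_noise_law M W n f) (\<lambda>y. (T y)\<^sup>2)"
  shows "((\<integral>y. T y \<partial>white_noise_law M W n g) - (\<integral>y. T y \<partial>white_noise_law M W n f))\<^sup>2
    \<le> (exp (real n * integral {0..1} (\<lambda>x. (g x - f x)\<^sup>2)) - 1)
        * (\<integral>y. (T y - m)\<^sup>2 \<partial>white_noise_law M W n f)"
proof -
  define P where "P = white_noise_law M W n f"
  define Q where "Q = white_noise_law M W n g"
  have prob: "prob_space P" "prob_space Q"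
    unfolding P_def Q_def using bm f g by (auto intro: prob_space_white_noise_law)
  have sets: "sets P = sets path_space" "sets Q = sets path_space" by (simp_all add: P_def Q_def)
  have fin: "finite_measure P" "finite_measure Q"
    using prob by (auto simp: prob_space_def)
  show ?thesis unfolding P_def[symmetric] Q_def[symmetric]
  proof (rule chi_square_bound_extend[where \<A>=dyadic_cylinders])
    fix A and \<epsilon> :: real assume A: "A \<in> sets P" "\<epsilon> > 0"
    have "AE y in P. y 0 = 0" "AE y in Q. y 0 = 0"
      unfolding P_def Q_def by (rule AE_white_noise_law_starts_at_0[OF bm]; fact)+
    then obtain B where "B \<in> dyadic_cylinders" "measure P (sym_diff A B) + measure Q (sym_diff A B) < \<epsilon>"
      using dyadic_cylinders_approximate[OF fin(1) sets(1) _ fin(2) sets(2), of A \<epsilon>] A sets(1) by blast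
    moreover have "0 \<le> measure P (sym_diff A B)" "0 \<le> measure Q (sym_diff A B)" by simp_all
    ultimately show "\<exists>B\<in>dyadic_cylinders. measure P (sym_diff A B) < \<epsilon> \<and> measure Q (sym_diff A B) < \<epsilon>"
      by (intro bexI[of _ B]) linarith+
  next
    fix I :: "real set" and r :: "real \<Rightarrow> real" and A m
    assume I: "finite I" and A: "\<And>i. i \<in> I \<Longrightarrow> A i \<in> dyadic_cylinders"
    have "\<exists>k B. \<forall>i\<in>I. B i \<in> sets (PiM {..<2 ^ k} (\<lambda>_. borel)) \<and> A i = increments k -` B i \<inter> space path_space"
      by (rule finite_dyadic_cylinders[OF I A])
    then obtain k B where "\<forall>i\<in>I. B i \<in> sets (PiM {..<2 ^ k} (\<lambda>_. borel)) \<and> A i = increments k -` B i \<inter> space path_space"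
      by (elim exE)
    then have B: "\<And>i. i \<in> I \<Longrightarrow> B i \<in> sets (PiM {..<2 ^ k} (\<lambda>_. borel))"
      "\<And>i. i \<in> I \<Longrightarrow> A i = increments k -` B i \<inter> space path_space"
      by simp_all
    define \<phi> where "\<phi> = (\<lambda>x. \<Sum>i\<in>I. r i * indicator (B i) x :: real)"
    define \<sigma> where "\<sigma> = 1 / sqrt (real n * 2 ^ k)"
    have \<sigma>: "\<sigma> > 0" "\<sigma>\<^sup>2 = 1 / (real n * 2 ^ k)" using n by (auto simp: \<sigma>_def power_divide)
    define a where "a = (\<lambda>(h :: real \<Rightarrow> real) i. integral {real i / 2 ^ k..real (Suc i) / 2 ^ k} h)"
    define G where "G = (\<lambda>a. PiM {..<2 ^ k :: nat} (\<lambda>i. density lborel (normal_density (a i) \<sigma>)))"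
    have \<phi>m: "\<phi> \<in> borel_measurable (PiM {..<2 ^ k} (\<lambda>_. borel))"
      unfolding \<phi>_def using B(1) by (intro borel_measurable_sum borel_measurable_times) auto
    have eq: "(\<Sum>i\<in>I. r i * indicator (A i) y) = \<phi> (increments k y)" if "y \<in> space path_space" for y
      unfolding \<phi>_def using that B(2) by (intro sum.cong) (auto simp: indicator_def)
    have distr: "distr P (PiM {..<2 ^ k} (\<lambda>_. borel)) (increments k) = G (a f)"
      "distr Q (PiM {..<2 ^ k} (\<lambda>_. borel)) (increments k) = G (a g)"
      unfolding P_def Q_def G_def a_def \<sigma>_def
      using distr_increments_white_noise_law[OF bm _ n] f g by auto
    \<comment> \<open>On an interval of length 2^(-k), the squared mean shift is at most 2^(-k)
      times the energy there. The variance n^(-1) 2^(-k) of an increment then cancels the length and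
      leaves the factor n.\<close>
    have "integral {0..1} (\<lambda>x. (g x - f x)\<^sup>2) \<ge> (\<Sum>i<2 ^ k. (a g i - a f i)\<^sup>2 * 2 ^ k)"
    proof -
      have c: "continuous_on {0..1} (\<lambda>x. g x - f x)" by (intro continuous_intros f g)
      have "(a g i - a f i)\<^sup>2 * 2 ^ k
          \<le> integral {real i / 2 ^ k..real (Suc i) / 2 ^ k} (\<lambda>x. (g x - f x)\<^sup>2)" if "i < 2 ^ k" for i
      proof -
        have sub: "{real i / 2 ^ k..real (Suc i) / 2 ^ k} \<subseteq> {0..1}"
          using dyadic_in_unit[of i k] dyadic_in_unit[of "Suc i" k] that by auto
        have "a g i - a f i = integral {real i / 2 ^ k..real (Suc i) / 2 ^ k} (\<lambda>x. g x - f x)"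
          unfolding a_def
          by (rule Henstock_Kurzweil_Integration.integral_diff[symmetric])
             (intro integrable_continuous_interval continuous_on_subset[OF f sub] continuous_on_subset[OF g sub])+
        moreover have "real (Suc i) / 2 ^ k - real i / 2 ^ k = 1 / 2 ^ k" by (simp add: field_simps)
        ultimately show ?thesis
          using integral_square_le[OF continuous_on_subset[OF c sub]]
          by (simp add: divide_right_mono field_simps)
      qed
      then have "(\<Sum>i<2 ^ k. (a g i - a f i)\<^sup>2 * 2 ^ k)
          \<le> (\<Sum>i<2 ^ k. integral {real i / 2 ^ k..real (Suc i) / 2 ^ k} (\<lambda>x. (g x - f x)\<^sup>2))"
        by (intro sum_mono) auto
      also have "\<dots> = integral {0..real (2 ^ k) / 2 ^ k} (\<lambda>x. (g x - f x)\<^sup>2)"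
        by (rule sum_integral_dyadic) (auto intro!: integrable_continuous_interval continuous_intros f g)
      finally show ?thesis by simp
    qed
    then have "real n * (\<Sum>i<2 ^ k. (a g i - a f i)\<^sup>2 * 2 ^ k) \<le> real n * integral {0..1} (\<lambda>x. (g x - f x)\<^sup>2)"
      by (rule mult_left_mono) simp
    moreover have "(\<Sum>i<2 ^ k. (a g i - a f i)\<^sup>2 / \<sigma>\<^sup>2) = real n * (\<Sum>i<2 ^ k. (a g i - a f i)\<^sup>2 * 2 ^ k)"
      by (simp add: \<sigma> sum_distrib_left mult_ac)
    ultimately have e: "exp (\<Sum>i<2 ^ k. (a g i - a f i)\<^sup>2 / \<sigma>\<^sup>2) - 1
        \<le> exp (real n * integral {0..1} (\<lambda>x. (g x - f x)\<^sup>2)) - 1" by simp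
    have trans: "(\<integral>y. u (\<Sum>i\<in>I. r i * indicator (A i) y) \<partial>R) = (\<integral>x. u (\<phi> x) \<partial>G b)"
      if [measurable]: "u \<in> borel_measurable borel" and R: "sets R = sets path_space"
        and "distr R (PiM {..<2 ^ k} (\<lambda>_. borel)) (increments k) = G b" for u :: "real \<Rightarrow> real" and R b
    proof -
      have "(\<integral>x. u (\<phi> x) \<partial>G b) = (\<integral>y. u (\<phi> (increments k y)) \<partial>R)"
        unfolding that(3)[symmetric]
        by (rule integral_distr) (use \<phi>m R in \<open>auto cong: measurable_cong_sets\<close>)
      also have "\<dots> = (\<integral>y. u (\<Sum>i\<in>I. r i * indicator (A i) y) \<partial>R)"
        using sets_eq_imp_space_eq[OF R] by (intro Bochner_Integration.integral_cong) (auto simp: eq)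
      finally show ?thesis by simp
    qed
    have "((\<integral>x. \<phi> x \<partial>G (a g)) - (\<integral>x. \<phi> x \<partial>G (a f)))\<^sup>2
      \<le> (exp (\<Sum>i<2 ^ k. (a g i - a f i)\<^sup>2 / \<sigma>\<^sup>2) - 1) * (\<integral>x. (\<phi> x - m)\<^sup>2 \<partial>G (a f))"
      unfolding G_def
    proof (rule chi_square_bound_normal)
      show "\<bar>\<phi> x\<bar> \<le> (\<Sum>i\<in>I. \<bar>r i\<bar>)" for x
        unfolding \<phi>_def by (rule order_trans[OF sum_abs]) (auto intro!: sum_mono simp: indicator_def)
    qed (use \<sigma> \<phi>m in auto)
    also have "\<dots> \<le> (exp (real n * integral {0..1} (\<lambda>x. (g x - f x)\<^sup>2)) - 1) * (\<integral>x. (\<phi> x - m)\<^sup>2 \<partial>G (a f))"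
      by (rule mult_right_mono[OF e]) simp
    finally show "((\<integral>x. (\<Sum>i\<in>I. r i * indicator (A i) x) \<partial>Q) - (\<integral>x. (\<Sum>i\<in>I. r i * indicator (A i) x) \<partial>P))\<^sup>2
      \<le> (exp (real n * integral {0..1} (\<lambda>x. (g x - f x)\<^sup>2)) - 1)
        * (\<integral>x. ((\<Sum>i\<in>I. r i * indicator (A i) x) - m)\<^sup>2 \<partial>P)"
      using trans[of "\<lambda>x. x", OF _ sets(1) distr(1)] trans[of "\<lambda>x. x", OF _ sets(2) distr(2)]
        trans[of "\<lambda>x. (x - m)\<^sup>2", OF _ sets(1) distr(1)] by simp
  qed (use prob sets T Tf Tg dyadic_cylinders_sets in \<open>auto simp: P_def Q_def cong: measurable_cong_sets\<close>)
qed

section \<open>Hoelder norms\<close>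

lemma vector_derivative_unit_interval:
  fixes f :: "real \<Rightarrow> real"
  assumes "x \<in> {0..1}" "(f has_vector_derivative d) (at x within {0..1})"
  shows "vector_derivative f (at x within {0..1}) = d"
  using assms by (intro vector_derivative_within_closed_interval) auto

lemma has_vector_derivative_add_scaled:
  fixes f K :: "real \<Rightarrow> real"
  assumes "f differentiable (at x within {0..1})" "K differentiable (at ((x - x0) / h))" "h \<noteq> 0"
  shows "((\<lambda>x. f x + c * K ((x - x0) / h)) has_vector_derivative
      (vector_derivative f (at x within {0..1}) + c / h * vector_derivative K (at ((x - x0) / h))))
      (at x within {0..1})"
proof -
  have f: "(f has_field_derivative vector_derivative f (at x within {0..1})) (at x within {0..1})"
    using assms(1) vector_derivative_works has_real_derivative_iff_has_vector_derivative by blast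
  have K: "(K has_field_derivative vector_derivative K (at ((x - x0) / h))) (at ((x - x0) / h))"
    using assms(2) vector_derivative_works has_real_derivative_iff_has_vector_derivative by blast
  have "((\<lambda>x. (x - x0) / h) has_field_derivative 1 / h) (at x within {0..1})"
    using assms(3) by (auto intro!: derivative_eq_intros)
  from DERIV_chain2[OF K this]
  have "((\<lambda>x. c * K ((x - x0) / h)) has_field_derivative c * (vector_derivative K (at ((x - x0) / h)) * (1 / h)))
      (at x within {0..1})" by (rule DERIV_cmult)
  from DERIV_add[OF f this] show ?thesis
    unfolding has_real_derivative_iff_has_vector_derivative[symmetric] by (simp add: mult.commute)
qed

lemma deriv_within_add_scaled:
  fixes f K :: "real \<Rightarrow> real"
  assumes f: "\<forall>l<m. deriv_within {0..1} l f differentiable_on {0..1}"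
    and K: "\<forall>l<m. deriv_within UNIV l K differentiable_on UNIV" and "h \<noteq> 0"
    and "l \<le> m" "x \<in> {0..1}"
  shows "deriv_within {0..1} l (\<lambda>x. f x + c * K ((x - x0) / h)) x
    = deriv_within {0..1} l f x + c / h ^ l * deriv_within UNIV l K ((x - x0) / h)"
  using \<open>l \<le> m\<close> \<open>x \<in> {0..1}\<close>
proof (induction l arbitrary: x)
  case (Suc l)
  have "((\<lambda>x. deriv_within {0..1} l f x + c / h ^ l * deriv_within UNIV l K ((x - x0) / h)) has_vector_derivative
      (deriv_within {0..1} (Suc l) f x + (c / h ^ l) / h * deriv_within UNIV (Suc l) K ((x - x0) / h)))
      (at x within {0..1})"
    unfolding deriv_within.simps
    by (rule has_vector_derivative_add_scaled)
       (use f K Suc.prems \<open>h \<noteq> 0\<close> in \<open>auto simp: differentiable_on_def Suc_le_eq\<close>)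
  \<comment> \<open>The induction hypothesis identifies the two functions on the unit interval only,
    which suffices for a derivative within that interval.\<close>
  then have "(deriv_within {0..1} l (\<lambda>x. f x + c * K ((x - x0) / h)) has_vector_derivative
      (deriv_within {0..1} (Suc l) f x + (c / h ^ l) / h * deriv_within UNIV (Suc l) K ((x - x0) / h)))
      (at x within {0..1})"
    by (rule has_vector_derivative_transform[rotated 2]) (use Suc in auto)
  from vector_derivative_unit_interval[OF Suc.prems(2) this] show ?case
    by (simp add: mult.commute)
qed simp

lemma differentiable_on_deriv_within_add_scaled:
  fixes f K :: "real \<Rightarrow> real"
  assumes f: "\<forall>l<m. deriv_within {0..1} l f differentiable_on {0..1}"
    and K: "\<forall>l<m. deriv_within UNIV l K differentiable_on UNIV" and "h \<noteq> 0" and "l < m"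
  shows "deriv_within {0..1} l (\<lambda>x. f x + c * K ((x - x0) / h)) differentiable_on {0..1}"
  unfolding differentiable_on_def
proof
  fix x :: real assume x: "x \<in> {0..1}"
  have "(\<lambda>x. deriv_within {0..1} l f x + c / h ^ l * deriv_within UNIV l K ((x - x0) / h)) differentiable (at x within {0..1})"
    using f K \<open>l < m\<close> \<open>h \<noteq> 0\<close> x
    by (intro differentiableI_vector[OF has_vector_derivative_add_scaled]) (auto simp: differentiable_on_def)
  then show "deriv_within {0..1} l (\<lambda>x. f x + c * K ((x - x0) / h)) differentiable (at x within {0..1})"
  proof (rule differentiable_transform_within[of _ _ _ 1])
    show "deriv_within {0..1} l f x + c / h ^ l * deriv_within UNIV l K ((x - x0) / h)
        = deriv_within {0..1} l (\<lambda>x. f x + c * K ((x - x0) / h)) x" if "x \<in> {0..1}" for x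
      using deriv_within_add_scaled[OF f K \<open>h \<noteq> 0\<close> less_imp_le[OF \<open>l < m\<close>] that] by simp
  qed (use x in auto)
qed

section \<open>Estimates by the Hoelder norm\<close>

lemma strict_floor_less: "\<beta> > 0 \<Longrightarrow> real (strict_floor \<beta>) < \<beta>"
  unfolding strict_floor_def by linarith

lemma holder_norm_finiteD:
  assumes "holder_norm \<beta> D f < \<infinity>"
  shows "\<forall>l<strict_floor \<beta>. deriv_within D l f differentiable_on D"
    and "holder_norm \<beta> D f = (\<Sum>l\<le>strict_floor \<beta>. SUP x\<in>D. ennreal \<bar>deriv_within D l f x\<bar>) +
      (SUP x\<in>D. SUP y\<in>D - {x}. ennreal (\<bar>deriv_within D (strict_floor \<beta>) f x - deriv_within D (strict_floor \<beta>) f y\<bar>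
        / \<bar>x - y\<bar> powr (\<beta> - real (strict_floor \<beta>))))"
  using assms by (auto simp: holder_norm_def Let_def split: if_splits)

lemma abs_deriv_within_le_holder_norm:
  assumes "holder_norm \<beta> D f < \<infinity>" "l \<le> strict_floor \<beta>" "x \<in> D"
  shows "ennreal \<bar>deriv_within D l f x\<bar> \<le> holder_norm \<beta> D f"
proof -
  have "ennreal \<bar>deriv_within D l f x\<bar> \<le> (SUP x\<in>D. ennreal \<bar>deriv_within D l f x\<bar>)"
    by (rule SUP_upper) fact
  also have "\<dots> \<le> (\<Sum>l\<le>strict_floor \<beta>. SUP x\<in>D. ennreal \<bar>deriv_within D l f x\<bar>)"
    by (rule member_le_sum) (use assms in auto)
  also have "\<dots> \<le> holder_norm \<beta> D f" unfolding holder_norm_finiteD(2)[OF assms(1)] by simp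
  finally show ?thesis .
qed

lemma holder_quotient_le_holder_norm:
  assumes "holder_norm \<beta> D f < \<infinity>" "x \<in> D" "y \<in> D" "x \<noteq> y"
  shows "ennreal (\<bar>deriv_within D (strict_floor \<beta>) f x - deriv_within D (strict_floor \<beta>) f y\<bar>
        / \<bar>x - y\<bar> powr (\<beta> - real (strict_floor \<beta>))) \<le> holder_norm \<beta> D f"
proof -
  let ?q = "\<lambda>x y. ennreal (\<bar>deriv_within D (strict_floor \<beta>) f x - deriv_within D (strict_floor \<beta>) f y\<bar>
        / \<bar>x - y\<bar> powr (\<beta> - real (strict_floor \<beta>)))"
  have "?q x y \<le> (SUP y\<in>D - {x}. ?q x y)" by (rule SUP_upper) (use assms in auto)
  also have "\<dots> \<le> (SUP x\<in>D. SUP y\<in>D - {x}. ?q x y)" by (rule SUP_upper) fact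
  also have "\<dots> \<le> holder_norm \<beta> D f" unfolding holder_norm_finiteD(2)[OF assms(1)] by simp
  finally show ?thesis .
qed

text \<open>The l-th derivative of the rescaled kernel carries the factor h^(\<beta> - l), which is
  at most 1 because l < \<beta> and h \<le> 1. In the Hoelder quotient the powers of h cancel
  exactly. Rescaling by h^\<beta> thus does not increase the norm.\<close>

lemma holder_norm_add_scaled:
  fixes f K :: "real \<Rightarrow> real"
  assumes f: "holder_norm \<beta> {0..1} f < \<infinity>" and K: "holder_norm \<beta> UNIV K < \<infinity>"
    and "0 < h" "h \<le> 1" "\<beta> > 0"
  shows "holder_norm \<beta> {0..1} (\<lambda>x. f x + c * h powr \<beta> * K ((x - x0) / h))
    \<le> holder_norm \<beta> {0..1} f + ennreal \<bar>c\<bar> * holder_norm \<beta> UNIV K"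
proof -
  define m where "m = strict_floor \<beta>"
  have m: "real m < \<beta>" using strict_floor_less \<open>\<beta> > 0\<close> by (simp add: m_def)
  define g where "g = (\<lambda>x. f x + c * h powr \<beta> * K ((x - x0) / h))"
  note fD = holder_norm_finiteD[OF f, folded m_def] and KD = holder_norm_finiteD[OF K, folded m_def]
  have g_eq: "deriv_within {0..1} l g x
      = deriv_within {0..1} l f x + c * h powr \<beta> / h ^ l * deriv_within UNIV l K ((x - x0) / h)"
    if "l \<le> m" "x \<in> {0..1}" for l x
    unfolding g_def by (rule deriv_within_add_scaled[OF fD(1) KD(1)]) (use that \<open>0 < h\<close> in auto)
  have coef: "c * h powr \<beta> / h ^ l = c * h powr (\<beta> - real l)" for l
    using \<open>0 < h\<close> by (simp add: powr_diff powr_realpow)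
  have coef_le: "\<bar>c * h powr \<beta> / h ^ l\<bar> \<le> \<bar>c\<bar>" if "l \<le> m" for l
  proof -
    have "h powr (\<beta> - real l) \<le> 1" using that m \<open>0 < h\<close> \<open>h \<le> 1\<close> by (intro powr_le1) auto
    then show ?thesis unfolding coef abs_mult using mult_left_mono[of "h powr (\<beta> - real l)" 1 "\<bar>c\<bar>"] by simp
  qed
  have diff: "\<forall>l<m. deriv_within {0..1} l g differentiable_on {0..1}"
    unfolding g_def using differentiable_on_deriv_within_add_scaled[OF fD(1) KD(1)] \<open>0 < h\<close> by auto
  have sup: "(SUP x\<in>{0..1}. ennreal \<bar>deriv_within {0..1} l g x\<bar>)
      \<le> (SUP x\<in>{0..1}. ennreal \<bar>deriv_within {0..1} l f x\<bar>) + ennreal \<bar>c\<bar> * (SUP x. ennreal \<bar>deriv_within UNIV l K x\<bar>)"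
    if "l \<le> m" for l
  proof (rule SUP_least)
    fix x :: real assume x: "x \<in> {0..1}"
    have "\<bar>deriv_within {0..1} l g x\<bar> \<le> \<bar>deriv_within {0..1} l f x\<bar> + \<bar>c\<bar> * \<bar>deriv_within UNIV l K ((x - x0) / h)\<bar>"
      unfolding g_eq[OF that x]
      by (rule order_trans[OF abs_triangle_ineq])
         (use mult_right_mono[OF coef_le[OF that] abs_ge_zero] in \<open>simp add: abs_mult\<close>)
    then have "ennreal \<bar>deriv_within {0..1} l g x\<bar>
        \<le> ennreal \<bar>deriv_within {0..1} l f x\<bar> + ennreal \<bar>c\<bar> * ennreal \<bar>deriv_within UNIV l K ((x - x0) / h)\<bar>"
      by (simp add: ennreal_plus[symmetric] ennreal_mult[symmetric] del: ennreal_plus)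
    also have "\<dots> \<le> (SUP x\<in>{0..1}. ennreal \<bar>deriv_within {0..1} l f x\<bar>) + ennreal \<bar>c\<bar> * (SUP x. ennreal \<bar>deriv_within UNIV l K x\<bar>)"
      using x by (intro add_mono mult_left_mono SUP_upper) auto
    finally show "ennreal \<bar>deriv_within {0..1} l g x\<bar> \<le> \<dots>" .
  qed
  define q where "q = (\<lambda>D u x y. ennreal (\<bar>deriv_within D m u x - deriv_within D m u y\<bar> / \<bar>x - y\<bar> powr (\<beta> - real m)))"
  have quot: "(SUP x\<in>{0..1}. SUP y\<in>{0..1} - {x}. q {0..1} g x y)
      \<le> (SUP x\<in>{0..1}. SUP y\<in>{0..1} - {x}. q {0..1} f x y) + ennreal \<bar>c\<bar> * (SUP x. SUP y\<in>UNIV - {x}. q UNIV K x y)"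
  proof (intro SUP_least)
    fix x y :: real assume x: "x \<in> {0..1}" and y: "y \<in> {0..1} - {x}"
    define x' y' where "x' = (x - x0) / h" and "y' = (y - x0) / h"
    have ne: "x' \<noteq> y'" using y \<open>0 < h\<close> by (auto simp: x'_def y'_def)
    have "\<bar>x - y\<bar> = h * \<bar>x' - y'\<bar>"
      using \<open>0 < h\<close> by (simp add: x'_def y'_def diff_divide_distrib[symmetric] abs_divide)
    then have scale: "\<bar>x - y\<bar> powr (\<beta> - real m) = h powr (\<beta> - real m) * \<bar>x' - y'\<bar> powr (\<beta> - real m)"
      using \<open>0 < h\<close> by (simp add: powr_mult)
    have "deriv_within {0..1} m g x - deriv_within {0..1} m g y = (deriv_within {0..1} m f x - deriv_within {0..1} m f y)
        + c * h powr (\<beta> - real m) * (deriv_within UNIV m K x' - deriv_within UNIV m K y')"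
      using x y by (simp add: g_eq x'_def y'_def coef algebra_simps)
    then have "\<bar>deriv_within {0..1} m g x - deriv_within {0..1} m g y\<bar> \<le> \<bar>deriv_within {0..1} m f x - deriv_within {0..1} m f y\<bar>
        + \<bar>c\<bar> * h powr (\<beta> - real m) * \<bar>deriv_within UNIV m K x' - deriv_within UNIV m K y'\<bar>"
      by (simp add: abs_mult order_trans[OF abs_triangle_ineq])
    then have "\<bar>deriv_within {0..1} m g x - deriv_within {0..1} m g y\<bar> / \<bar>x - y\<bar> powr (\<beta> - real m)
        \<le> \<bar>deriv_within {0..1} m f x - deriv_within {0..1} m f y\<bar> / \<bar>x - y\<bar> powr (\<beta> - real m)
        + (\<bar>c\<bar> * h powr (\<beta> - real m) * \<bar>deriv_within UNIV m K x' - deriv_within UNIV m K y'\<bar>) / \<bar>x - y\<bar> powr (\<beta> - real m)"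
      unfolding add_divide_distrib[symmetric] by (rule divide_right_mono) simp
    also have "(\<bar>c\<bar> * h powr (\<beta> - real m) * \<bar>deriv_within UNIV m K x' - deriv_within UNIV m K y'\<bar>) / \<bar>x - y\<bar> powr (\<beta> - real m)
        = \<bar>c\<bar> * (\<bar>deriv_within UNIV m K x' - deriv_within UNIV m K y'\<bar> / \<bar>x' - y'\<bar> powr (\<beta> - real m))"
      unfolding scale using \<open>0 < h\<close> by simp
    finally have "q {0..1} g x y \<le> q {0..1} f x y + ennreal \<bar>c\<bar> * q UNIV K x' y'"
      unfolding q_def by (simp add: ennreal_plus[symmetric] ennreal_mult[symmetric] del: ennreal_plus)
    also have "\<dots> \<le> (SUP x\<in>{0..1}. SUP y\<in>{0..1} - {x}. q {0..1} f x y) + ennreal \<bar>c\<bar> * (SUP x. SUP y\<in>UNIV - {x}. q UNIV K x y)"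
      using x y ne by (intro add_mono mult_left_mono SUP_upper2[of x] SUP_upper2[of x'] SUP_upper) auto
    finally show "q {0..1} g x y \<le> \<dots>" .
  qed
  have "holder_norm \<beta> {0..1} g = (\<Sum>l\<le>m. SUP x\<in>{0..1}. ennreal \<bar>deriv_within {0..1} l g x\<bar>)
      + (SUP x\<in>{0..1}. SUP y\<in>{0..1} - {x}. q {0..1} g x y)"
    using diff by (simp add: holder_norm_def Let_def m_def q_def)
  also have "\<dots> \<le> (\<Sum>l\<le>m. (SUP x\<in>{0..1}. ennreal \<bar>deriv_within {0..1} l f x\<bar>)
        + ennreal \<bar>c\<bar> * (SUP x. ennreal \<bar>deriv_within UNIV l K x\<bar>))
      + ((SUP x\<in>{0..1}. SUP y\<in>{0..1} - {x}. q {0..1} f x y) + ennreal \<bar>c\<bar> * (SUP x. SUP y\<in>UNIV - {x}. q UNIV K x y))"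
    by (intro add_mono sum_mono sup quot) auto
  also have "\<dots> = holder_norm \<beta> {0..1} f + ennreal \<bar>c\<bar> * holder_norm \<beta> UNIV K"
    unfolding fD(2) KD(2) q_def by (simp add: sum.distrib sum_distrib_left distrib_left add_ac)
  finally show ?thesis by (simp add: g_def)
qed

text \<open>Makes the zero function available as the centre of the perturbations in (i). The
  iterated derivatives are computed on the unit interval only, since outside it a derivative within
  the interval is unspecified.\<close>

lemma holder_norm_zero: "holder_norm \<beta> {0..1} (\<lambda>_. 0) = 0"
proof -
  have *: "deriv_within {0..1} l (\<lambda>_. 0) x = 0" if "x \<in> {0..1}" for l x
    using that
  proof (induction l arbitrary: x)
    case (Suc l)
    have "(deriv_within {0..1} l (\<lambda>_. 0) has_vector_derivative 0) (at x within {0..1})"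
      by (rule has_vector_derivative_transform[OF _ _ has_vector_derivative_const[of 0]]) (use Suc in auto)
    from vector_derivative_unit_interval[OF Suc.prems this] show ?case by simp
  qed simp
  have "deriv_within {0..1} l (\<lambda>_. 0) differentiable_on {0..1}" for l
    unfolding differentiable_on_def
    by (intro ballI differentiable_transform_within[OF differentiable_const[of 0] zero_less_one]) (simp_all add: *)
  moreover have "(SUP x\<in>{0..1 :: real}. ennreal \<bar>deriv_within {0..1} l (\<lambda>_. 0) x\<bar>) = 0" for l
    by (rule antisym[OF SUP_least]) (simp_all add: *)
  moreover have "(SUP x\<in>{0..1 :: real}. SUP y\<in>{0..1} - {x}.
      ennreal (\<bar>deriv_within {0..1} l (\<lambda>_. 0) x - deriv_within {0..1} l (\<lambda>_. 0) y\<bar> / \<bar>x - y\<bar> powr r)) = 0" for l r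
  proof (rule antisym[OF SUP_least[OF SUP_least]])
    fix x y :: real assume "x \<in> {0..1}" "y \<in> {0..1} - {x}"
    then show "ennreal (\<bar>deriv_within {0..1} l (\<lambda>_. 0) x - deriv_within {0..1} l (\<lambda>_. 0) y\<bar> / \<bar>x - y\<bar> powr r) \<le> 0"
      by (simp add: *)
  qed simp
  ultimately show ?thesis unfolding holder_norm_def Let_def by simp
qed

text \<open>If \<beta> \<le> 1, this is the Hoelder quotient; if \<beta> > 1, the norm bounds the
  first derivative and the mean value inequality applies. The resulting modulus of continuity
  depends on the function only through V, hence is uniform over a ball.\<close>

lemma holder_norm_increment_le:
  fixes K :: "real \<Rightarrow> real"
  assumes K: "holder_norm \<beta> D K \<le> ennreal V" and "0 \<le> V" and D: "convex D" "x \<in> D" "y \<in> D" and "\<bar>x - y\<bar> \<le> 1" "\<beta> > 0"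
  shows "\<bar>K x - K y\<bar> \<le> V * \<bar>x - y\<bar> powr (min \<beta> 1)"
proof (cases "x = y")
  case ne: False
  have fin: "holder_norm \<beta> D K < \<infinity>" using order_le_less_trans[OF K ennreal_less_top] by simp
  show ?thesis
  proof (cases "strict_floor \<beta> = 0")
    case True
    then have "\<beta> \<le> 1" by (simp add: strict_floor_def)
    have "ennreal (\<bar>K x - K y\<bar> / \<bar>x - y\<bar> powr \<beta>) \<le> ennreal V"
      using order_trans[OF holder_quotient_le_holder_norm[OF fin D(2,3) ne] K] True by simp
    then have "\<bar>K x - K y\<bar> / \<bar>x - y\<bar> powr \<beta> \<le> V" using \<open>0 \<le> V\<close> by simp
    with ne \<open>\<beta> \<le> 1\<close> show ?thesis by (simp add: divide_le_eq)
  next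
    case False
    then have "\<beta> > 1" by (simp add: strict_floor_def)
    have K1: "\<bar>vector_derivative K (at z within D)\<bar> \<le> V" if "z \<in> D" for z
    proof -
      have "ennreal \<bar>deriv_within D 1 K z\<bar> \<le> ennreal V"
        using order_trans[OF abs_deriv_within_le_holder_norm[OF fin _ that, of 1] K] False by simp
      with \<open>0 \<le> V\<close> show ?thesis by simp
    qed
    have "K differentiable_on D" using holder_norm_finiteD(1)[OF fin] False by force
    then have "norm (K x - K y) \<le> V * norm (x - y)"
      using D K1
      by (intro field_differentiable_bound[of D K "\<lambda>z. vector_derivative K (at z within D)"])
         (auto simp: differentiable_on_def has_real_derivative_iff_has_vector_derivative vector_derivative_works[symmetric])
    with \<open>\<beta> > 1\<close> ne show ?thesis by simp
  qed
qed (use \<open>0 \<le> V\<close> in simp)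

lemma holder_norm_finite_continuous_on:
  assumes fin: "holder_norm \<beta> D f < \<infinity>" and "convex D" "\<beta> > 0"
  shows "continuous_on D f"
proof (rule continuous_onI)
  fix x e :: real assume x: "x \<in> D" and e: "e > 0"
  define V where "V = enn2real (holder_norm \<beta> D f)"
  define a where "a = min \<beta> 1"
  have a: "a > 0" using \<open>\<beta> > 0\<close> by (simp add: a_def)
  \<comment> \<open>The choice makes V d^a at most V e / (2 (V + 1)), hence at most e; adding 1 to V
    covers V = 0.\<close>
  define d where "d = min 1 ((e / (2 * (V + 1))) powr (1 / a))"
  have V: "V \<ge> 0" "holder_norm \<beta> D f = ennreal V"
    using fin by (auto simp: V_def)
  have d: "d > 0" "d \<le> 1" using V e by (auto simp: d_def)
  show "\<exists>d>0. \<forall>y\<in>D. dist y x < d \<longrightarrow> dist (f y) (f x) \<le> e"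
  proof (intro exI[of _ d] conjI d(1) ballI impI)
    fix y assume y: "y \<in> D" "dist y x < d"
    have "\<bar>f y - f x\<bar> \<le> V * \<bar>y - x\<bar> powr a"
      unfolding a_def by (rule holder_norm_increment_le) (use V \<open>convex D\<close> x y d \<open>\<beta> > 0\<close> in \<open>auto simp: dist_real_def\<close>)
    also have "\<dots> \<le> V * (e / (2 * (V + 1)))"
    proof (rule mult_left_mono[OF _ V(1)])
      have "\<bar>y - x\<bar> powr a \<le> ((e / (2 * (V + 1))) powr (1 / a)) powr a"
        using y d a by (intro powr_mono2) (auto simp: dist_real_def d_def)
      then show "\<bar>y - x\<bar> powr a \<le> e / (2 * (V + 1))" using a V e by (simp add: powr_powr)
    qed
    also have "\<dots> \<le> e" using V e by (simp add: divide_le_eq mult.commute mult_left_mono)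
    finally show "dist (f y) (f x) \<le> e" by (simp add: dist_real_def)
  qed
qed

section \<open>Bias and variance\<close>

text \<open>Substitution over the whole line produces the factor h, and restriction to the unit
  interval only decreases the integral. The position of \<open>x0\<close>, even at an end point,
  therefore does not affect the bound.\<close>

lemma integral_scaled_square_le:
  fixes K :: "real \<Rightarrow> real"
  assumes K: "continuous_on UNIV K" and I: "(\<integral>\<^sup>+x. ennreal ((K x)\<^sup>2) \<partial>lborel) = ennreal k" "0 \<le> k" and "0 < h"
  shows "integral {0..1} (\<lambda>x. (c * K ((x - x0) / h))\<^sup>2) \<le> c\<^sup>2 * h * k"
proof -
  define u where "u = (\<lambda>x. (c * K ((x - x0) / h))\<^sup>2)"
  have [measurable]: "K \<in> borel_measurable borel" using K by (rule borel_measurable_continuous_onI)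
  have "(\<integral>\<^sup>+x. ennreal (u x) \<partial>lborel) = ennreal h * (\<integral>\<^sup>+x. ennreal (u (x0 + h * x)) \<partial>lborel)"
    using \<open>0 < h\<close> by (subst nn_integral_real_affine[of _ h x0]) (simp_all add: u_def)
  also have "(\<lambda>x. ennreal (u (x0 + h * x))) = (\<lambda>x. ennreal (c\<^sup>2) * ennreal ((K x)\<^sup>2))"
    using \<open>0 < h\<close> by (simp add: u_def power_mult_distrib ennreal_mult)
  also have "ennreal h * (\<integral>\<^sup>+x. ennreal (c\<^sup>2) * ennreal ((K x)\<^sup>2) \<partial>lborel) = ennreal (c\<^sup>2 * h * k)"
    using \<open>0 < h\<close> I by (subst nn_integral_cmult) (simp_all add: ennreal_mult[symmetric] mult_ac)
  finally have nn: "(\<integral>\<^sup>+x. ennreal (u x) \<partial>lborel) = ennreal (c\<^sup>2 * h * k)" .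
  have u: "integrable lborel u"
    by (rule integrableI_nonneg) (simp_all add: nn, simp_all add: u_def)
  have "integral\<^sup>L lborel u = c\<^sup>2 * h * k"
    using \<open>0 < h\<close> I(2) nn by (subst integral_eq_nn_integral) (auto simp: u_def)
  then have "(u has_integral c\<^sup>2 * h * k) UNIV"
    using has_integral_integral_lborel[OF u] by simp
  moreover have "u integrable_on {0..1}"
    unfolding u_def
    by (intro integrable_continuous_interval continuous_intros continuous_on_compose2[OF K]) (use \<open>0 < h\<close> in auto)
  ultimately have "integral {0..1} u \<le> integral UNIV u"
    by (intro integral_subset_le) (auto simp: u_def)
  with \<open>(u has_integral c\<^sup>2 * h * k) UNIV\<close> show ?thesis by (simp add: integral_unique u_def)
qed

text \<open>By the uniform modulus of continuity K stays above 1/2 on an interval [0, d] with d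
  depending on V and \<beta> alone. This excludes kernels with vanishing norm and bounds
  \<open>gamma_bar\<close> from above.\<close>

lemma holder_norm_L2_lower_bound:
  assumes "0 < V" "0 < \<beta>"
  shows "\<exists>\<delta>>0. \<forall>K. holder_norm \<beta> UNIV K \<le> ennreal V \<longrightarrow> K 0 = 1 \<longrightarrow>
    ennreal \<delta> \<le> (\<integral>\<^sup>+x. ennreal ((K x)\<^sup>2) \<partial>lborel)"
proof -
  define a where "a = min \<beta> 1"
  have a: "a > 0" using \<open>0 < \<beta>\<close> by (simp add: a_def)
  \<comment> \<open>Chosen so that V d^a \<le> 1/2, where 1 is the value of K at 0.\<close>
  define d where "d = min 1 ((1 / (2 * V)) powr (1 / a))"
  have d: "0 < d" "d \<le> 1" using \<open>0 < V\<close> by (auto simp: d_def)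
  have "ennreal (d / 4) \<le> (\<integral>\<^sup>+x. ennreal ((K x)\<^sup>2) \<partial>lborel)"
    if K: "holder_norm \<beta> UNIV K \<le> ennreal V" "K 0 = 1" for K
  proof -
    have "1 / 4 \<le> (K x)\<^sup>2" if x: "x \<in> {0..d}" for x
    proof -
      have "\<bar>K x - K 0\<bar> \<le> V * \<bar>x - 0\<bar> powr a"
        unfolding a_def by (rule holder_norm_increment_le[OF K(1)]) (use assms x d in auto)
      also have "\<dots> \<le> V * ((1 / (2 * V)) powr (1 / a)) powr a"
        using x a \<open>0 < V\<close> by (intro mult_left_mono powr_mono2) (auto simp: d_def)
      also have "\<dots> = 1 / 2" using a \<open>0 < V\<close> by (simp add: powr_powr)
      finally have "\<bar>K x - 1\<bar> \<le> 1 / 2" using K(2) by simp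
      then have "1 / 2 \<le> K x" by linarith
      then have "(1 / 2)\<^sup>2 \<le> (K x)\<^sup>2" by (intro power_mono) auto
      then show ?thesis by (simp add: power2_eq_square)
    qed
    then have "ennreal (1 / 4) * indicator {0..d} x \<le> ennreal ((K x)\<^sup>2)" for x
      by (auto simp: indicator_def intro!: ennreal_leI)
    then have "(\<integral>\<^sup>+x. ennreal (1 / 4) * indicator {0..d} x \<partial>lborel) \<le> (\<integral>\<^sup>+x. ennreal ((K x)\<^sup>2) \<partial>lborel)"
      by (intro nn_integral_mono)
    moreover have "(\<integral>\<^sup>+x. ennreal (1 / 4) * indicator {0..d} x \<partial>lborel) = ennreal (d / 4)"
      using d by (subst nn_integral_cmult_indicator) (auto simp: ennreal_mult[symmetric])
    ultimately show ?thesis by simp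
  qed
  with d show ?thesis by (intro exI[of _ "d / 4"]) auto
qed

lemma holder_ball_continuous_on:
  assumes "f \<in> holder_ball \<beta> R" "\<beta> > 0"
  shows "continuous_on {0..1} f"
  using assms order_le_less_trans[OF _ ennreal_less_top, of "holder_norm \<beta> {0..1} f" R]
  by (intro holder_norm_finite_continuous_on[of \<beta>]) (auto simp: holder_ball_def)

section \<open>Lower bounds from a single kernel\<close>

lemma expectation_difference_le:
  fixes P and F and M :: "'a measure" and W and n :: nat and \<beta> R :: real
  defines "P \<equiv> white_noise_law M W n" and "F \<equiv> holder_ball \<beta> R"
  assumes bm: "std_brownian_motion M W" and n: "n \<ge> 1" and "\<beta> > 0"
    and T: "T \<in> estimators P F" and f: "f \<in> F" and g: "g \<in> F"
    and v: "Var P T f \<le> ennreal v" "0 \<le> v"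
    and e: "integral {0..1} (\<lambda>x. (g x - f x)\<^sup>2) \<le> e"
  shows "((\<integral>y. T y \<partial>P g) - (\<integral>y. T y \<partial>P f))\<^sup>2 \<le> (exp (real n * e) - 1) * v"
proof -
  define m where "m = (\<integral>y. T y \<partial>P f)"
  have cont: "continuous_on {0..1} f" "continuous_on {0..1} g"
    using f g holder_ball_continuous_on \<open>\<beta> > 0\<close> by (auto simp: F_def)
  have Tm: "T \<in> borel_measurable path_space" and Tf: "integrable (P f) T" and Tg: "integrable (P g) T"
    using T f g by (auto simp: estimators_def)
  interpret Pf: prob_space "P f" unfolding P_def by (rule prob_space_white_noise_law) fact+
  have [measurable]: "T \<in> borel_measurable (P f)" using Tf by auto
  have Var: "(\<integral>\<^sup>+y. ennreal ((T y - m)\<^sup>2) \<partial>P f) \<le> ennreal v"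
    using v by (simp add: Var_def m_def)
  have i: "integrable (P f) (\<lambda>y. (T y - m)\<^sup>2)"
    by (rule integrableI_nonneg) (use order_le_less_trans[OF Var ennreal_less_top] in auto)
  have Vle: "(\<integral>y. (T y - m)\<^sup>2 \<partial>P f) \<le> v"
    using Var v(2) i by (simp add: nn_integral_eq_integral)
  \<comment> \<open>A finite variance bound is turned into square integrability of T, as the
    \<chi>^2 bound requires.\<close>
  have "integrable (P f) (\<lambda>y. (T y - m)\<^sup>2 + 2 * m * T y - m\<^sup>2)" using i Tf by simp
  also have "(\<lambda>y. (T y - m)\<^sup>2 + 2 * m * T y - m\<^sup>2) = (\<lambda>y. (T y)\<^sup>2)"
    by (auto simp: power2_eq_square algebra_simps)
  finally have "((\<integral>y. T y \<partial>P g) - (\<integral>y. T y \<partial>P f))\<^sup>2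
      \<le> (exp (real n * integral {0..1} (\<lambda>x. (g x - f x)\<^sup>2)) - 1) * (\<integral>y. (T y - m)\<^sup>2 \<partial>P f)"
    unfolding P_def using Tm Tg by (intro chi_square_bound_white_noise bm n cont) (auto simp: P_def)
  also have "\<dots> \<le> (exp (real n * e) - 1) * v"
  proof (rule mult_mono)
    have "0 \<le> integral {0..1} (\<lambda>x. (g x - f x)\<^sup>2)"
      by (rule Henstock_Kurzweil_Integration.integral_nonneg)
         (auto intro!: integrable_continuous_interval continuous_intros cont)
    with e show "0 \<le> exp (real n * e) - 1" by simp
    show "exp (real n * integral {0..1} (\<lambda>x. (g x - f x)\<^sup>2)) - 1 \<le> exp (real n * e) - 1"
      using e by (simp add: mult_left_mono)
  qed (use Vle in auto)
  finally show ?thesis .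
qed

lemma exp_minus_1_le: "exp x - 1 \<le> x * exp x" for x :: real
proof -
  have "(1 - x) * exp x \<le> exp (- x) * exp x"
    using exp_ge_add_one_self[of "- x"] by (intro mult_right_mono) auto
  then show ?thesis by (simp add: exp_minus algebra_simps)
qed

text \<open>Here r is room left in the Hoelder ball around f, later taken as R minus the norm of f.
  Both perturbations are compared with f itself, so that the variance at f is the only one to
  appear.\<close>

lemma variance_lower_bound_at_function:
  fixes P and F and M :: "'a measure" and W and n :: nat and \<beta> R :: real
  defines "P \<equiv> white_noise_law M W n" and "F \<equiv> holder_ball \<beta> R"
  assumes bm: "std_brownian_motion M W" and n: "n \<ge> 1" and "\<beta> > 0"
    and T: "T \<in> estimators P F" and f: "f \<in> F"
    and v: "Var P T f \<le> ennreal v" "0 \<le> v"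
    and h: "0 < h" "h \<le> 1" and C: "real n * h powr (2 * \<beta> + 1) \<le> C"
    and bias: "\<And>g. g \<in> F \<Longrightarrow> \<bar>Bias P x0 T g\<bar> \<le> h powr \<beta>"
    and K: "holder_norm \<beta> UNIV K = ennreal V" "K 0 = 1" "0 < V"
    and k: "(\<integral>\<^sup>+x. ennreal ((K x)\<^sup>2) \<partial>lborel) = ennreal k" "0 < k"
    and r: "V < r" and fr: "holder_norm \<beta> {0..1} f + ennreal r \<le> ennreal R"
  shows "(1 - V / r)\<^sup>2 / k * exp (- C * r\<^sup>2 * (k / V\<^sup>2)) \<le> real n * h * v"
proof -
  \<comment> \<open>The largest factor that keeps the perturbation's norm bound within r.\<close>
  define c where "c = r / V"
  have c: "1 < c" using r K(3) by (simp add: c_def)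
  define b where "b = h powr \<beta>"
  have b: "0 < b" using h by (simp add: b_def)
  define g where "g = (\<lambda>s x. f x + s * c * h powr \<beta> * K ((x - x0) / h))"
  define E where "E = (\<lambda>f. \<integral>y. T y \<partial>P f)"
  have fin: "holder_norm \<beta> {0..1} f < \<infinity>"
    using f order_le_less_trans[OF _ ennreal_less_top, of "holder_norm \<beta> {0..1} f" R] by (auto simp: F_def holder_ball_def)
  have gF: "g s \<in> F" if "\<bar>s\<bar> = 1" for s
  proof -
    have "holder_norm \<beta> {0..1} (g s) \<le> holder_norm \<beta> {0..1} f + ennreal \<bar>s * c\<bar> * holder_norm \<beta> UNIV K"
      unfolding g_def by (rule holder_norm_add_scaled) (use fin K h \<open>\<beta> > 0\<close> in auto)
    also have "ennreal \<bar>s * c\<bar> * holder_norm \<beta> UNIV K = ennreal r"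
      using that c K by (simp add: abs_mult ennreal_mult[symmetric] c_def)
    finally show ?thesis using fr by (simp add: F_def holder_ball_def)
  qed
  define e where "e = c\<^sup>2 * b\<^sup>2 * h * k"
  have cont: "continuous_on UNIV K"
    by (rule holder_norm_finite_continuous_on[of \<beta>]) (use K \<open>\<beta> > 0\<close> in auto)
  have energy: "integral {0..1} (\<lambda>x. (g s x - f x)\<^sup>2) \<le> e" if "\<bar>s\<bar> = 1" for s
  proof -
    have "integral {0..1} (\<lambda>x. ((s * c * b) * K ((x - x0) / h))\<^sup>2) \<le> (s * c * b)\<^sup>2 * h * k"
      by (rule integral_scaled_square_le[OF cont]) (use k h in auto)
    moreover have "s\<^sup>2 = 1" using that by (metis one_power2 power2_abs)
    ultimately show ?thesis by (simp add: g_def e_def b_def power_mult_distrib)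
  qed
  have step: "(E (g s) - E f)\<^sup>2 \<le> (exp (real n * e) - 1) * v" if "\<bar>s\<bar> = 1" for s
    unfolding E_def P_def
    by (rule expectation_difference_le[OF bm n \<open>\<beta> > 0\<close>])
       (use T f gF v energy that in \<open>auto simp: P_def F_def\<close>)
  have gx: "g s x0 = f x0 + s * c * b" for s using K by (simp add: g_def b_def)
  have "E (g 1) - E (g (- 1)) = 2 * c * b + Bias P x0 T (g 1) - Bias P x0 T (g (- 1))"
    by (simp add: Bias_def E_def gx)
  then have "2 * ((c - 1) * b) \<le> (E (g 1) - E f) + (E f - E (g (- 1)))"
    using bias[OF gF[of 1]] bias[OF gF[of "- 1"]] by (simp add: b_def algebra_simps)
  \<comment> \<open>Comparing both perturbations at once is what gives the factor \<open>1 - V / r\<close> instead of \<open>1 - 2 V / r\<close>.\<close>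
  then consider "(c - 1) * b \<le> E (g 1) - E f" | "(c - 1) * b \<le> E f - E (g (- 1))" by linarith
  then have "((c - 1) * b)\<^sup>2 \<le> (exp (real n * e) - 1) * v"
  proof cases
    case 1
    then have "((c - 1) * b)\<^sup>2 \<le> (E (g 1) - E f)\<^sup>2" using b c by (intro power_mono) auto
    with step[of 1] show ?thesis by simp
  next
    case 2
    then have "((c - 1) * b)\<^sup>2 \<le> (E f - E (g (- 1)))\<^sup>2" using b c by (intro power_mono) auto
    with step[of "- 1"] show ?thesis by (simp add: power2_commute)
  qed
  \<comment> \<open>Only the exponent is replaced by its bound through C. The linear factor n e is
    kept, since it holds the power of h that remains after division by b^2.\<close>
  also have "\<dots> \<le> (real n * e * exp (C * (c\<^sup>2 * k))) * v"
  proof (rule mult_right_mono[OF _ v(2)])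
    have "b\<^sup>2 * h = h powr (2 * \<beta> + 1)"
    proof -
      have "b\<^sup>2 * h = h powr \<beta> * h powr \<beta> * h powr 1" using h by (simp add: b_def power2_eq_square)
      also have "\<dots> = h powr (2 * \<beta> + 1)" unfolding powr_add[symmetric] by simp
      finally show ?thesis .
    qed
    moreover have "real n * e = (real n * (b\<^sup>2 * h)) * (c\<^sup>2 * k)" by (simp add: e_def mult_ac)
    ultimately have "real n * e = (real n * h powr (2 * \<beta> + 1)) * (c\<^sup>2 * k)" by (simp only:)
    also have "\<dots> \<le> C * (c\<^sup>2 * k)" using k by (intro mult_right_mono[OF C]) auto
    finally have "exp (real n * e) \<le> exp (C * (c\<^sup>2 * k))" by simp
    moreover have "0 \<le> real n * e" using h k by (simp add: e_def)
    ultimately have "real n * e * exp (real n * e) \<le> real n * e * exp (C * (c\<^sup>2 * k))"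
      by (rule mult_left_mono)
    with exp_minus_1_le[of "real n * e"] show "exp (real n * e) - 1 \<le> real n * e * exp (C * (c\<^sup>2 * k))" by linarith
  qed
  finally have "b\<^sup>2 * (c - 1)\<^sup>2 \<le> b\<^sup>2 * (real n * h * v * (c\<^sup>2 * k) * exp (C * (c\<^sup>2 * k)))"
    by (simp add: e_def power_mult_distrib mult_ac)
  then have "(c - 1)\<^sup>2 \<le> real n * h * v * (c\<^sup>2 * k) * exp (C * (c\<^sup>2 * k))"
    by (rule mult_left_le_imp_le) (use b in simp)
  then have "(c - 1)\<^sup>2 / (c\<^sup>2 * k) * exp (- (C * (c\<^sup>2 * k))) \<le> real n * h * v"
    using c k by (simp only: exp_minus) (simp add: field_simps)
  \<comment> \<open>The gap c - 1 relative to the amplitude c is the factor 1 - V / r of the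
    constant.\<close>
  moreover have "(c - 1)\<^sup>2 / (c\<^sup>2 * k) = (1 - V / r)\<^sup>2 / k"
  proof -
    have "1 - V / r = (c - 1) / c" using c r K(3) by (simp add: c_def field_simps)
    then show ?thesis by (simp add: power_divide)
  qed
  moreover have "C * (c\<^sup>2 * k) = C * r\<^sup>2 * (k / V\<^sup>2)" by (simp add: c_def power_divide)
  ultimately show ?thesis by simp
qed

text \<open>Nothing bounds n h^(2\<beta>+1) here, so a single comparison would leave an uncontrolled
  exponential. The functions \<open>g s\<close> with |s| \<le> 1 all lie in the ball and have
  variance at most v, so the comparison can be chained along the segment from s = -1 to s =
  1.\<close>

lemma sup_variance_lower_bound:
  fixes P and F and M :: "'a measure" and W and n :: nat and \<beta> R :: real
  defines "P \<equiv> white_noise_law M W n" and "F \<equiv> holder_ball \<beta> R"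
  assumes bm: "std_brownian_motion M W" and n: "n \<ge> 1" and "\<beta> > 0"
    and T: "T \<in> estimators P F"
    and v: "\<And>g. g \<in> F \<Longrightarrow> Var P T g \<le> ennreal v" "0 \<le> v"
    and h: "0 < h" "h \<le> 1"
    and bias: "\<And>g. g \<in> F \<Longrightarrow> \<bar>Bias P x0 T g\<bar> \<le> h powr \<beta>"
    and K: "holder_norm \<beta> UNIV K = ennreal V" "K 0 = 1" "0 < V"
    and k: "(\<integral>\<^sup>+x. ennreal ((K x)\<^sup>2) \<partial>lborel) = ennreal k" "0 < k"
    and R: "V < R"
  shows "(1 - V / R)\<^sup>2 / k \<le> real n * h * v"
proof -
  define c where "c = R / V"
  have c: "1 < c" using R K(3) by (simp add: c_def)
  define b where "b = h powr \<beta>"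
  have b: "0 < b" using h by (simp add: b_def)
  \<comment> \<open>The summand 0 presents \<open>g s\<close> as a perturbation of the zero
    function, in the shape of \<open>holder_norm_add_scaled\<close>.\<close>
  define g where "g = (\<lambda>s x. 0 + s * c * h powr \<beta> * K ((x - x0) / h))"
  define E where "E = (\<lambda>f. \<integral>y. T y \<partial>P f)"
  have gF: "g s \<in> F" if "\<bar>s\<bar> \<le> 1" for s
  proof -
    have "holder_norm \<beta> {0..1} (g s) \<le> holder_norm \<beta> {0..1} (\<lambda>_. 0) + ennreal \<bar>s * c\<bar> * holder_norm \<beta> UNIV K"
      unfolding g_def by (rule holder_norm_add_scaled) (use K h \<open>\<beta> > 0\<close> in \<open>auto simp: holder_norm_zero\<close>)
    also have "\<dots> = ennreal (\<bar>s\<bar> * R)"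
      using c K by (simp add: abs_mult ennreal_mult[symmetric] c_def holder_norm_zero)
    also have "\<dots> \<le> ennreal R" using that K R by (intro ennreal_leI) (simp add: mult_left_le_one_le)
    finally show ?thesis by (simp add: F_def holder_ball_def)
  qed
  define e where "e = c\<^sup>2 * b\<^sup>2 * h * k"
  have e: "0 \<le> e" using h k by (simp add: e_def)
  have cont: "continuous_on UNIV K"
    by (rule holder_norm_finite_continuous_on[of \<beta>]) (use K \<open>\<beta> > 0\<close> in auto)
  have energy: "integral {0..1} (\<lambda>x. (g s x - g t x)\<^sup>2) \<le> (s - t)\<^sup>2 * e" for s t
  proof -
    have "integral {0..1} (\<lambda>x. (((s - t) * c * b) * K ((x - x0) / h))\<^sup>2) \<le> ((s - t) * c * b)\<^sup>2 * h * k"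
      by (rule integral_scaled_square_le[OF cont]) (use k h in auto)
    moreover have "g s x - g t x = ((s - t) * c * b) * K ((x - x0) / h)" for x
      by (simp add: g_def b_def algebra_simps)
    ultimately show ?thesis by (simp add: e_def power_mult_distrib mult_ac)
  qed
  have step: "(E (g s) - E (g t))\<^sup>2 \<le> (exp (real n * ((s - t)\<^sup>2 * e)) - 1) * v" if "\<bar>s\<bar> \<le> 1" "\<bar>t\<bar> \<le> 1" for s t
    unfolding E_def P_def
    by (rule expectation_difference_le[OF bm n \<open>\<beta> > 0\<close>])
       (use T gF v energy that in \<open>auto simp: P_def F_def\<close>)
  define D where "D = \<bar>E (g 1) - E (g (- 1))\<bar>"
  \<comment> \<open>Many small steps along the segment turn the factor \<open>exp x - 1\<close> into \<open>x\<close>.\<close>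
  have D_le: "D\<^sup>2 \<le> 4 * real n * e * exp (4 * real n * e / (real (Suc j))\<^sup>2) * v" for j
  proof -
    define N where "N = Suc j"
    have N: "0 < real N" by (simp add: N_def)
    define t where "t = (\<lambda>i. 2 * real i / real N - 1)"
    have t: "\<bar>t i\<bar> \<le> 1" if "i \<le> N" for i
    proof -
      have "2 * real i / real N \<le> 2" using that N by (simp add: divide_le_eq)
      then show ?thesis by (simp add: t_def abs_le_iff)
    qed
    \<comment> \<open>The exponent of one step of length 2 / N; N steps of size sqrt((exp x - 1) v)
      have squared total N^2 (exp x - 1) v, and N^2 x does not depend on N.\<close>
    define x where "x = 4 * real n * e / (real N)\<^sup>2"
    have x: "0 \<le> x" using e by (simp add: x_def)
    have inc: "\<bar>E (g (t (Suc i))) - E (g (t i))\<bar> \<le> sqrt ((exp x - 1) * v)" if "i < N" for i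
    proof (rule real_le_rsqrt)
      have "t (Suc i) - t i = 2 / real N" using N by (simp add: t_def field_simps)
      then have "real n * ((t (Suc i) - t i)\<^sup>2 * e) = x" by (simp add: x_def power_divide)
      with step[OF t t, of "Suc i" i] that
      show "\<bar>E (g (t (Suc i))) - E (g (t i))\<bar>\<^sup>2 \<le> (exp x - 1) * v" by simp
    qed
    have "E (g 1) - E (g (- 1)) = (\<Sum>i<N. E (g (t (Suc i))) - E (g (t i)))"
      unfolding sum_lessThan_telescope[of "\<lambda>i. E (g (t i))" N] using N by (simp add: t_def)
    then have "D \<le> (\<Sum>i<N. \<bar>E (g (t (Suc i))) - E (g (t i))\<bar>)"
      unfolding D_def by simp
    also have "\<dots> \<le> (\<Sum>i<N. sqrt ((exp x - 1) * v))" by (rule sum_mono) (simp add: inc)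
    finally have "D \<le> real N * sqrt ((exp x - 1) * v)" by simp
    then have "D\<^sup>2 \<le> (real N * sqrt ((exp x - 1) * v))\<^sup>2" by (intro power_mono) (auto simp: D_def)
    also have "\<dots> = (real N)\<^sup>2 * ((exp x - 1) * v)" using x v(2) by (simp add: power_mult_distrib)
    also have "\<dots> \<le> (real N)\<^sup>2 * ((x * exp x) * v)"
      using v(2) exp_minus_1_le[of x] by (intro mult_left_mono mult_right_mono) auto
    also have "\<dots> = 4 * real n * e * exp x * v" using N by (simp add: x_def)
    finally show ?thesis by (simp add: x_def N_def)
  qed
  have "(\<lambda>j. 4 * real n * e / (real (Suc j))\<^sup>2) \<longlonglongrightarrow> 0"
  proof -
    have "(\<lambda>j. 4 * real n * e * (inverse (real (Suc j)))\<^sup>2) \<longlonglongrightarrow> 4 * real n * e * 0\<^sup>2"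
      by (intro tendsto_intros LIMSEQ_inverse_real_of_nat)
    then show ?thesis by (simp add: divide_inverse power_inverse del: of_nat_Suc)
  qed
  then have "(\<lambda>j. 4 * real n * e * exp (4 * real n * e / (real (Suc j))\<^sup>2) * v) \<longlonglongrightarrow> 4 * real n * e * exp 0 * v"
    by (intro tendsto_intros)
  from LIMSEQ_le_const[OF this] D_le have D_le: "D\<^sup>2 \<le> 4 * real n * e * v" by auto
  have gx: "g s x0 = s * c * b" for s using K by (simp add: g_def b_def)
  have "E (g 1) - E (g (- 1)) = 2 * c * b + Bias P x0 T (g 1) - Bias P x0 T (g (- 1))"
    by (simp add: Bias_def E_def gx)
  \<comment> \<open>The values at \<open>x0\<close> differ by 2 c b, and the two biases can reduce
    the difference of the expectations by at most 2 b.\<close>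
  then have "2 * ((c - 1) * b) \<le> D"
    unfolding D_def using bias[OF gF[of 1]] bias[OF gF[of "- 1"]] by (simp add: b_def algebra_simps)
  then have "(2 * ((c - 1) * b))\<^sup>2 \<le> D\<^sup>2" using b c by (intro power_mono) auto
  moreover have "(2 * ((c - 1) * b))\<^sup>2 = (4 * b\<^sup>2) * (c - 1)\<^sup>2" by (simp add: power_mult_distrib)
  moreover have "4 * real n * e * v = (4 * b\<^sup>2) * (real n * h * v * (c\<^sup>2 * k))" by (simp add: e_def)
  ultimately have "(4 * b\<^sup>2) * (c - 1)\<^sup>2 \<le> (4 * b\<^sup>2) * (real n * h * v * (c\<^sup>2 * k))"
    using D_le by linarith
  then have "(c - 1)\<^sup>2 \<le> real n * h * v * (c\<^sup>2 * k)" using b by simp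
  then have "(c - 1)\<^sup>2 / (c\<^sup>2 * k) \<le> real n * h * v"
    using c k by (simp add: divide_le_eq)
  moreover have "(c - 1)\<^sup>2 / (c\<^sup>2 * k) = (1 - V / R)\<^sup>2 / k"
  proof -
    have "1 - V / R = (c - 1) / c" using c R K(3) by (simp add: c_def field_simps)
    then show ?thesis by (simp add: power_divide)
  qed
  ultimately show ?thesis by simp
qed

section \<open>From kernels to the constants\<close>

text \<open>Separates the kernels that contribute nothing, because their inverse norm is 0, from
  those described by positive reals V and k. Positivity of both comes from K 0 = 1, for k by way of
  the uniform lower bound on the integral of K^2.\<close>

lemma holder_kernel_cases:
  assumes "K \<in> holder_space \<beta>" "K 0 = 1" "\<beta> > 0"
  obtains (infinite) V where "holder_norm \<beta> UNIV K = ennreal V" "0 < V" "L2_norm K = \<infinity>"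
  | (finite) V k where "holder_norm \<beta> UNIV K = ennreal V" "0 < V"
      "(\<integral>\<^sup>+x. ennreal ((K x)\<^sup>2) \<partial>lborel) = ennreal k" "0 < k" "L2_norm K = ennreal (sqrt k)"
proof -
  define V where "V = enn2real (holder_norm \<beta> UNIV K)"
  have fin: "holder_norm \<beta> UNIV K < \<infinity>" using assms(1) by (simp add: holder_space_def)
  then have V: "holder_norm \<beta> UNIV K = ennreal V" by (simp add: V_def)
  have "ennreal 1 \<le> ennreal V"
    using abs_deriv_within_le_holder_norm[OF fin, of 0 0] assms(2) V by simp
  then have V0: "0 < V" by (subst (asm) ennreal_le_iff2) auto
  show thesis
  proof (cases "(\<integral>\<^sup>+x. ennreal ((K x)\<^sup>2) \<partial>lborel) = \<infinity>")
    case True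
    with V V0 infinite show ?thesis by (simp add: L2_norm_def)
  next
    case False
    define k where "k = enn2real (\<integral>\<^sup>+x. ennreal ((K x)\<^sup>2) \<partial>lborel)"
    have k: "(\<integral>\<^sup>+x. ennreal ((K x)\<^sup>2) \<partial>lborel) = ennreal k"
      using False by (simp add: k_def top.not_eq_extremum)
    obtain \<delta> where "\<delta> > 0" "ennreal \<delta> \<le> ennreal k"
      using holder_norm_L2_lower_bound[OF V0 \<open>\<beta> > 0\<close>] V assms(2) k by (metis order_refl)
    then have "0 < k" by (subst (asm) ennreal_le_iff2) auto
    moreover have "L2_norm K = ennreal (sqrt k)" using k False \<open>0 < k\<close> by (simp add: L2_norm_def)
    ultimately show ?thesis using finite V V0 k by blast
  qed
qed

lemma inverse_sqrt_mult_ennreal_power2: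
  assumes "0 < V" "V < r" "0 < k"
  shows "(inverse (ennreal (sqrt k)) * ennreal (max 0 (1 - V / r)))\<^sup>2 = ennreal ((1 - V / r)\<^sup>2 / k)"
proof -
  have "(inverse (ennreal (sqrt k)) * ennreal (max 0 (1 - V / r)))\<^sup>2 = (ennreal (inverse (sqrt k) * (1 - V / r)))\<^sup>2"
    using assms by (simp add: inverse_ennreal ennreal_mult)
  also have "\<dots> = ennreal ((inverse (sqrt k) * (1 - V / r))\<^sup>2)"
    using assms by (intro ennreal_power) simp
  also have "(inverse (sqrt k) * (1 - V / r))\<^sup>2 = (1 - V / r)\<^sup>2 / k"
    using assms by (simp add: power_mult_distrib power_inverse divide_inverse mult.commute)
  finally show ?thesis .
qed

text \<open>Kernels with V \<ge> R or infinite norm give the value 0, so real inequalities for the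
  remaining kernels bound the extended-real supremum.\<close>

lemma gamma_const_le:
  assumes "R > 0" "\<beta> > 0" "0 \<le> u"
    and u: "\<And>K V k. holder_norm \<beta> UNIV K = ennreal V \<Longrightarrow> K 0 = 1 \<Longrightarrow> 0 < V \<Longrightarrow> V < R \<Longrightarrow>
      (\<integral>\<^sup>+x. ennreal ((K x)\<^sup>2) \<partial>lborel) = ennreal k \<Longrightarrow> 0 < k \<Longrightarrow> (1 - V / R)\<^sup>2 / k \<le> u"
  shows "gamma_const R \<beta> \<le> ennreal u"
  unfolding gamma_const_def
proof (rule SUP_least)
  fix K assume "K \<in> {K \<in> holder_space \<beta>. K 0 = 1}"
  then have K: "K \<in> holder_space \<beta>" "K 0 = 1" by auto
  from K \<open>\<beta> > 0\<close> show "(inverse (L2_norm K) * ennreal (max 0 (1 - enn2real (holder_norm \<beta> UNIV K) / R)))\<^sup>2 \<le> ennreal u"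
  proof (cases rule: holder_kernel_cases)
    case (finite V k)
    show ?thesis
    proof (cases "V < R")
      case True
      then have "(inverse (L2_norm K) * ennreal (max 0 (1 - enn2real (holder_norm \<beta> UNIV K) / R)))\<^sup>2
          = ennreal ((1 - V / R)\<^sup>2 / k)"
        using finite inverse_sqrt_mult_ennreal_power2[of V R k] by simp
      also have "\<dots> \<le> ennreal u"
        by (rule ennreal_leI[OF u]) (use finite K True in auto)
      finally show ?thesis .
    next
      case False
      with finite \<open>R > 0\<close> show ?thesis by (simp add: max_def)
    qed
  qed simp
qed

lemma gamma_bar_le:
  assumes "a < R" "\<beta> > 0" "0 \<le> u"
    and u: "\<And>K V k. holder_norm \<beta> UNIV K = ennreal V \<Longrightarrow> K 0 = 1 \<Longrightarrow> 0 < V \<Longrightarrow> V < R - a \<Longrightarrow>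
      (\<integral>\<^sup>+x. ennreal ((K x)\<^sup>2) \<partial>lborel) = ennreal k \<Longrightarrow> 0 < k \<Longrightarrow>
      (1 - V / (R - a))\<^sup>2 / k * exp (- C * (R - a)\<^sup>2 * (k / V\<^sup>2)) \<le> u"
  shows "gamma_bar R \<beta> C a \<le> ennreal u"
proof -
  have "(inverse (L2_norm K) * ennreal (max 0 (1 - enn2real (holder_norm \<beta> UNIV K) / (R - a))))\<^sup>2 *
      ennreal (exp (- C * (R - a)\<^sup>2 * ((enn2real (L2_norm K))\<^sup>2 / (enn2real (holder_norm \<beta> UNIV K))\<^sup>2))) \<le> ennreal u"
    if K: "K \<in> holder_space \<beta>" "K 0 = 1" for K
    using K \<open>\<beta> > 0\<close>
  proof (cases rule: holder_kernel_cases)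
    case (finite V k)
    show ?thesis
    proof (cases "V < R - a")
      case True
      then have 1: "(inverse (L2_norm K) * ennreal (max 0 (1 - V / (R - a))))\<^sup>2 = ennreal ((1 - V / (R - a))\<^sup>2 / k)"
        using finite inverse_sqrt_mult_ennreal_power2[of V "R - a" k] by simp
      have 2: "(enn2real (L2_norm K))\<^sup>2 = k" "enn2real (holder_norm \<beta> UNIV K) = V"
        using finite by simp_all
      have "ennreal ((1 - V / (R - a))\<^sup>2 / k * exp (- C * (R - a)\<^sup>2 * (k / V\<^sup>2))) \<le> ennreal u"
        by (rule ennreal_leI[OF u]) (use finite K True in auto)
      then show ?thesis unfolding 2 1 using finite by (subst ennreal_mult[symmetric]) auto
    next
      case False
      with finite \<open>a < R\<close> show ?thesis by (simp add: max_def)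
    qed
  qed simp
  then show ?thesis using \<open>a < R\<close> unfolding gamma_bar_def by (auto intro!: SUP_least)
qed

text \<open>Finiteness matters because \<open>\<infinity> / \<infinity> = 0\<close> in \<^typ>\<open>ennreal\<close>.\<close>

lemma gamma_bar_finite:
  assumes "\<beta> > 0" "C \<ge> 0"
  shows "gamma_bar R \<beta> C a < \<infinity>"
proof (cases "a < R")
  case True
  then obtain \<delta> where \<delta>: "\<delta> > 0" "\<And>K. holder_norm \<beta> UNIV K \<le> ennreal (R - a) \<Longrightarrow> K 0 = 1 \<Longrightarrow>
      ennreal \<delta> \<le> (\<integral>\<^sup>+x. ennreal ((K x)\<^sup>2) \<partial>lborel)"
    using holder_norm_L2_lower_bound[of "R - a" \<beta>] \<open>\<beta> > 0\<close> by auto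
  \<comment> \<open>Only kernels with V < R - a contribute, and one \<delta> bounds k from below for
    all of them.\<close>
  have "gamma_bar R \<beta> C a \<le> ennreal (1 / \<delta>)"
  proof (rule gamma_bar_le)
    fix K V k
    assume K: "holder_norm \<beta> UNIV K = ennreal V" "K 0 = 1" "0 < V" "V < R - a"
      and k: "(\<integral>\<^sup>+x. ennreal ((K x)\<^sup>2) \<partial>lborel) = ennreal k" "0 < k"
    have "\<delta> \<le> k" using \<delta>(2)[of K] K k by simp
    have "(1 - V / (R - a))\<^sup>2 \<le> 1\<^sup>2" using K by (intro power_mono) auto
    then have "(1 - V / (R - a))\<^sup>2 / k \<le> 1 / \<delta>"
      using \<open>\<delta> \<le> k\<close> \<open>\<delta> > 0\<close> by (intro frac_le) auto
    moreover have "exp (- C * (R - a)\<^sup>2 * (k / V\<^sup>2)) \<le> 1"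
      using \<open>C \<ge> 0\<close> k by (simp add: mult_nonneg_nonneg)
    ultimately have "(1 - V / (R - a))\<^sup>2 / k * exp (- C * (R - a)\<^sup>2 * (k / V\<^sup>2)) \<le> 1 / \<delta> * 1"
      using \<open>\<delta> > 0\<close> by (intro mult_mono) auto
    then show "(1 - V / (R - a))\<^sup>2 / k * exp (- C * (R - a)\<^sup>2 * (k / V\<^sup>2)) \<le> 1 / \<delta>" by simp
  qed (use True \<open>\<beta> > 0\<close> \<open>\<delta> > 0\<close> in auto)
  then show ?thesis using order_le_less_trans[OF _ ennreal_less_top] by simp
qed (simp add: gamma_bar_def)

section \<open>The bandwidth and the two trade-offs\<close>

text \<open>For \<open>s = 0\<close>, i.e. an unbiased estimator, \<open>h\<close> tends to \<open>0\<close>.\<close>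

lemma bandwidth_limit:
  fixes X n s v C \<beta> :: real
  assumes "0 < n" "0 \<le> v" "0 < \<beta>" "0 < C" "0 \<le> s" "s \<le> 1" "n * s powr (2 * \<beta> + 1) \<le> C"
    and X: "\<And>h. 0 < h \<Longrightarrow> h \<le> 1 \<Longrightarrow> s \<le> h \<Longrightarrow> n * h powr (2 * \<beta> + 1) \<le> C \<Longrightarrow> X \<le> n * h * v"
  shows "X \<le> n * s * v"
proof (cases "s = 0")
  case True
  have "X \<le> 0"
  proof (rule ccontr)
    assume "\<not> X \<le> 0"
    \<comment> \<open>The three bounds give h \<le> 1, then n h^(2\<beta>+1) \<le> C, and finally n
      h v < X, which contradicts the hypothesis on X.\<close>
    define h where "h = min (min 1 ((C / n) powr (1 / (2 * \<beta> + 1)))) (X / (2 * (n * v + 1)))"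
    have nv: "0 \<le> n * v" using assms by simp
    have "0 < X / (2 * (n * v + 1))" using \<open>\<not> X \<le> 0\<close> nv by (intro divide_pos_pos) auto
    then have h: "0 < h" "h \<le> 1" using assms by (auto simp: h_def)
    have "h powr (2 * \<beta> + 1) \<le> ((C / n) powr (1 / (2 * \<beta> + 1))) powr (2 * \<beta> + 1)"
      using h assms by (intro powr_mono2) (auto simp: h_def)
    also have "\<dots> = C / n" using assms by (simp add: powr_powr)
    finally have "n * h powr (2 * \<beta> + 1) \<le> C" using assms by (simp add: field_simps)
    from X[OF h _ this] True h have "X \<le> n * v * h" by (simp add: mult_ac)
    also have "\<dots> \<le> n * v * (X / (2 * (n * v + 1)))" using nv by (intro mult_left_mono) (auto simp: h_def)
    also have "\<dots> < X" using \<open>\<not> X \<le> 0\<close> nv by (simp add: divide_less_eq algebra_simps add_nonneg_pos)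
    finally show False by simp
  qed
  with True show ?thesis by simp
next
  case False
  with assms show ?thesis by (intro X) auto
qed

lemma bias_le_powr:
  assumes "\<beta> > 0" "0 \<le> s" "s \<le> h" "\<bar>b\<bar> powr (1 / \<beta>) \<le> s"
  shows "\<bar>b :: real\<bar> \<le> h powr \<beta>"
proof -
  have "\<bar>b\<bar> = (\<bar>b\<bar> powr (1 / \<beta>)) powr \<beta>" using assms(1) by (simp add: powr_powr)
  also have "\<dots> \<le> h powr \<beta>" using assms by (intro powr_mono2) auto
  finally show ?thesis .
qed

text \<open>Converts the class constraints into bandwidth constraints: B = 1 gives s \<le> 1, and B
  = (C/n)^(\<beta>/(2\<beta>+1)) gives s \<le> (C/n)^(1/(2\<beta>+1)), which is n s^(2\<beta>+1)
  \<le> C.\<close>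

lemma SUP_bias_powr:
  fixes b :: "'c \<Rightarrow> real"
  assumes "\<beta> > 0" "0 \<le> B" and lt: "(SUP f\<in>F. ennreal \<bar>b f\<bar>) < ennreal B"
  shows "(SUP f\<in>F. ennreal (\<bar>b f\<bar> powr (1 / \<beta>))) \<le> ennreal (B powr (1 / \<beta>))"
proof (rule SUP_least)
  fix f assume "f \<in> F"
  then have "ennreal \<bar>b f\<bar> < ennreal B" using lt by (meson SUP_upper order_le_less_trans)
  then show "ennreal (\<bar>b f\<bar> powr (1 / \<beta>)) \<le> ennreal (B powr (1 / \<beta>))"
    using assms by (intro ennreal_leI powr_mono2) (auto simp: ennreal_less_iff)
qed

text \<open>With s the supremum of |Bias|^(1/\<beta>), every h in (0, 1] with h \<ge> s is
  admissible, and \<open>bandwidth_limit\<close> brings the bound down to h = s. An infinite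
  variance is settled by the convention on products.\<close>

lemma sup_variance_tradeoff:
  fixes P and F and M :: "'a measure" and W and n :: nat and \<beta> R :: real
  defines "P \<equiv> white_noise_law M W n" and "F \<equiv> holder_ball \<beta> R"
  assumes bm: "std_brownian_motion M W" and n: "n \<ge> 1" and "\<beta> > 0" "R > 0"
    and T: "T \<in> class_T P F x0"
  shows "gamma_const R \<beta> / of_nat n
    \<le> (SUP f\<in>F. ennreal (\<bar>Bias P x0 T f\<bar> powr (1 / \<beta>))) \<cdot>\<^sub>\<infinity> (SUP f\<in>F. Var P T f)"
proof -
  define S where "S = (SUP f\<in>F. ennreal (\<bar>Bias P x0 T f\<bar> powr (1 / \<beta>)))"
  define Vs where "Vs = (SUP f\<in>F. Var P T f)"
  have "S \<le> ennreal (1 powr (1 / \<beta>))"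
    unfolding S_def by (rule SUP_bias_powr) (use T \<open>\<beta> > 0\<close> in \<open>auto simp: class_T_def\<close>)
  then obtain s where s: "S = ennreal s" "0 \<le> s" "s \<le> 1"
    by (cases S) (auto simp: top_unique)
  have Tr: "\<bar>Bias P x0 T f\<bar> powr (1 / \<beta>) \<le> s" if "f \<in> F" for f
    using SUP_upper[OF that, of "\<lambda>f. ennreal (\<bar>Bias P x0 T f\<bar> powr (1 / \<beta>))"] s unfolding S_def[symmetric] by simp
  show ?thesis unfolding S_def[symmetric] Vs_def[symmetric]
  proof (cases "Vs = \<infinity>")
    case False
    then obtain v where v: "Vs = ennreal v" "0 \<le> v" by (cases Vs) auto
    have "gamma_const R \<beta> \<le> ennreal (real n * s * v)"
    proof (rule gamma_const_le)
      fix K V k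
      assume K: "holder_norm \<beta> UNIV K = ennreal V" "K 0 = 1" "0 < V" "V < R"
        and k: "(\<integral>\<^sup>+x. ennreal ((K x)\<^sup>2) \<partial>lborel) = ennreal k" "0 < k"
      have n_le: "real n * h powr (2 * \<beta> + 1) \<le> real n" if "0 \<le> h" "h \<le> 1" for h
        using that \<open>\<beta> > 0\<close> by (simp add: mult_left_le powr_le1)
      show "(1 - V / R)\<^sup>2 / k \<le> real n * s * v"
      \<comment> \<open>With n in the role of C, the condition n h^(2\<beta>+1) \<le> C merely
        restates h \<le> 1.\<close>
      proof (rule bandwidth_limit[of _ _ \<beta> "real n"])
        fix h assume h: "0 < h" "h \<le> 1" "s \<le> h"
        show "(1 - V / R)\<^sup>2 / k \<le> real n * h * v"
        proof (rule sup_variance_lower_bound[OF bm n \<open>\<beta> > 0\<close>])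
          show "Var (white_noise_law M W n) T g \<le> ennreal v" if "g \<in> holder_ball \<beta> R" for g
            using SUP_upper[OF that, of "Var P T"] v(1) by (simp add: Vs_def P_def F_def)
          show "\<bar>Bias (white_noise_law M W n) x0 T g\<bar> \<le> h powr \<beta>" if "g \<in> holder_ball \<beta> R" for g
            using bias_le_powr[OF \<open>\<beta> > 0\<close> s(2) h(3) Tr[of g]] that by (simp add: P_def F_def)
        qed (use T v h K k in \<open>auto simp: class_T_def P_def F_def\<close>)
      qed (use n v \<open>\<beta> > 0\<close> s n_le in auto)
    qed (use \<open>R > 0\<close> \<open>\<beta> > 0\<close> s v in auto)
    then have "gamma_const R \<beta> / of_nat n \<le> ennreal (real n * s * v) / of_nat n"
      by (rule divide_right_mono_ennreal)
    also have "\<dots> = ennreal (s * v)"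
      using n s v by (simp add: ennreal_of_nat_eq_real_of_nat divide_ennreal)
    also have "\<dots> = S \<cdot>\<^sub>\<infinity> Vs" using s v by (simp add: mult_infty_def ennreal_mult)
    finally show "gamma_const R \<beta> / of_nat n \<le> S \<cdot>\<^sub>\<infinity> Vs" .
  qed (simp add: mult_infty_def)
qed

text \<open>The core is the inequality \<gamma> f \<le> n s v for each f of finite variance v; the
  rest divides by \<gamma> f and s under the conventions for 0 and \<infinity>.\<close>

lemma pointwise_variance_tradeoff:
  fixes P and F and M :: "'a measure" and W and n :: nat and \<beta> R :: real
  defines "P \<equiv> white_noise_law M W n" and "F \<equiv> holder_ball \<beta> R"
  assumes bm: "std_brownian_motion M W" and n: "n \<ge> 1" and "\<beta> > 0" "R > 0" "C > 0"
    and T: "T \<in> class_S P F x0 n \<beta> C"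
  shows "1 / of_nat n
    \<le> (SUP f\<in>F. ennreal (\<bar>Bias P x0 T f\<bar> powr (1 / \<beta>))) \<cdot>\<^sub>\<infinity>
      (INF f\<in>F. Var P T f /\<^sub>\<infinity> gamma_bar R \<beta> C (enn2real (holder_norm \<beta> {0..1} f)))"
proof -
  define S where "S = (SUP f\<in>F. ennreal (\<bar>Bias P x0 T f\<bar> powr (1 / \<beta>)))"
  define \<gamma> where "\<gamma> = (\<lambda>f. gamma_bar R \<beta> C (enn2real (holder_norm \<beta> {0..1} f)))"
  define J where "J = (INF f\<in>F. Var P T f /\<^sub>\<infinity> \<gamma> f)"
  have "S \<le> ennreal (1 powr (1 / \<beta>))"
    unfolding S_def by (rule SUP_bias_powr) (use T \<open>\<beta> > 0\<close> in \<open>auto simp: class_T_def class_S_def\<close>)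
  then obtain s where s: "S = ennreal s" "0 \<le> s" "s \<le> 1"
    by (cases S) (auto simp: top_unique)
  have "S \<le> ennreal (((C / real n) powr (\<beta> / (2 * \<beta> + 1))) powr (1 / \<beta>))"
    unfolding S_def by (rule SUP_bias_powr) (use T \<open>\<beta> > 0\<close> in \<open>auto simp: class_S_def\<close>)
  then have "s \<le> (C / real n) powr (1 / (2 * \<beta> + 1))"
    using s \<open>\<beta> > 0\<close> by (simp add: powr_powr)
  then have "s powr (2 * \<beta> + 1) \<le> ((C / real n) powr (1 / (2 * \<beta> + 1))) powr (2 * \<beta> + 1)"
    using s \<open>\<beta> > 0\<close> by (intro powr_mono2) auto
  also have "\<dots> = C / real n" using \<open>\<beta> > 0\<close> \<open>C > 0\<close> n by (simp add: powr_powr)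
  finally have sC: "real n * s powr (2 * \<beta> + 1) \<le> C" using n by (simp add: field_simps)
  have Tr: "\<bar>Bias P x0 T f\<bar> powr (1 / \<beta>) \<le> s" if "f \<in> F" for f
    using SUP_upper[OF that, of "\<lambda>f. ennreal (\<bar>Bias P x0 T f\<bar> powr (1 / \<beta>))"] s unfolding S_def[symmetric] by simp
  have \<gamma>_le: "\<gamma> f \<le> ennreal (real n * s * v)" if f: "f \<in> F" and v: "Var P T f = ennreal v" "0 \<le> v" for f v
  proof -
    define a where "a = enn2real (holder_norm \<beta> {0..1} f)"
    have fR: "holder_norm \<beta> {0..1} f \<le> ennreal R" using f by (simp add: F_def holder_ball_def)
    then have a: "holder_norm \<beta> {0..1} f = ennreal a"
      using order_le_less_trans[OF fR ennreal_less_top] by (simp add: a_def)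
    show ?thesis
    proof (cases "a < R")
      case True
      have "gamma_bar R \<beta> C a \<le> ennreal (real n * s * v)"
      proof (rule gamma_bar_le[OF True \<open>\<beta> > 0\<close>])
        fix K V k
        assume K: "holder_norm \<beta> UNIV K = ennreal V" "K 0 = 1" "0 < V" "V < R - a"
          and k: "(\<integral>\<^sup>+x. ennreal ((K x)\<^sup>2) \<partial>lborel) = ennreal k" "0 < k"
        show "(1 - V / (R - a))\<^sup>2 / k * exp (- C * (R - a)\<^sup>2 * (k / V\<^sup>2)) \<le> real n * s * v"
        proof (rule bandwidth_limit[of _ _ \<beta> C])
          fix h assume h: "0 < h" "h \<le> 1" "s \<le> h" "real n * h powr (2 * \<beta> + 1) \<le> C"
          show "(1 - V / (R - a))\<^sup>2 / k * exp (- C * (R - a)\<^sup>2 * (k / V\<^sup>2)) \<le> real n * h * v"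
          proof (rule variance_lower_bound_at_function[OF bm n \<open>\<beta> > 0\<close>, of T R f])
            show "\<bar>Bias (white_noise_law M W n) x0 T g\<bar> \<le> h powr \<beta>" if "g \<in> holder_ball \<beta> R" for g
              using bias_le_powr[OF \<open>\<beta> > 0\<close> s(2) h(3) Tr[of g]] that by (simp add: P_def F_def)
            have "ennreal a + ennreal (R - a) = ennreal R"
              using True by (subst ennreal_plus[symmetric]) (auto simp: a_def)
            then show "holder_norm \<beta> {0..1} f + ennreal (R - a) \<le> ennreal R" using a by simp
          qed (use T f v h K k in \<open>auto simp: class_S_def P_def F_def\<close>)
        qed (use n v \<open>\<beta> > 0\<close> \<open>C > 0\<close> s sC in auto)
      qed (use s v in auto)
      then show ?thesis by (simp add: \<gamma>_def a_def)
    next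
      case False
      then show ?thesis by (simp add: \<gamma>_def a_def[symmetric] gamma_bar_def)
    qed
  qed
  have \<gamma>_fin: "\<gamma> f < \<infinity>" for f
    unfolding \<gamma>_def by (rule gamma_bar_finite) (use \<open>\<beta> > 0\<close> \<open>C > 0\<close> in auto)
  \<comment> \<open>If s = 0, a finite variance forces \<gamma> f = 0 and an infinite one meets a
    finite \<gamma> f. The ratio is infinite in both cases, and then the product with s = 0 is
    infinite by convention.\<close>
  have ratio: "Var P T f /\<^sub>\<infinity> \<gamma> f \<ge> (if s = 0 then \<infinity> else ennreal (1 / (real n * s)))" if f: "f \<in> F" for f
  proof (cases "\<gamma> f = 0")
    case \<gamma>0: False
    obtain g where g: "\<gamma> f = ennreal g" "0 < g"
      using \<gamma>_fin[of f] \<gamma>0 by (cases "\<gamma> f") (auto simp: less_le)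
    show ?thesis
    proof (cases "Var P T f")
      case (real v)
      from \<gamma>_le[OF f this(2,1)] g have gv: "g \<le> real n * s * v"
        by (simp add: ennreal_le_iff2)
      then have "s \<noteq> 0" using g by auto
      with s gv g n have "1 / (real n * s) \<le> v / g" by (simp add: field_simps)
      then have "ennreal (1 / (real n * s)) \<le> ennreal v / ennreal g"
        using real g by (simp add: divide_ennreal ennreal_leI)
      with \<gamma>0 g real \<open>s \<noteq> 0\<close> show ?thesis by (simp add: ratio_infty_def)
    next
      case top
      with \<gamma>0 g show ?thesis by (simp add: ratio_infty_def ennreal_top_divide)
    qed
  qed (simp add: ratio_infty_def)
  then have J: "J \<ge> (if s = 0 then \<infinity> else ennreal (1 / (real n * s)))"
    unfolding J_def by (intro INF_greatest)
  have "1 / of_nat n \<le> S \<cdot>\<^sub>\<infinity> J"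
  proof (cases "J = \<infinity>")
    case False
    with J have "s \<noteq> 0" by (auto simp: top_unique)
    have "1 / of_nat n = ennreal (1 / real n)"
      using n by (simp add: ennreal_of_nat_eq_real_of_nat divide_ennreal flip: ennreal_1)
    also have "\<dots> = ennreal s * ennreal (1 / (real n * s))"
      using s \<open>s \<noteq> 0\<close> by (subst ennreal_mult[symmetric]) auto
    also have "\<dots> \<le> ennreal s * J" using J \<open>s \<noteq> 0\<close> by (intro mult_left_mono) auto
    finally show ?thesis using False s by (simp add: mult_infty_def)
  qed (simp add: mult_infty_def)
  then show ?thesis by (simp add: S_def J_def \<gamma>_def)
qed

theorem theorem3p1:
  fixes M :: "'a measure" and W :: "real \<Rightarrow> 'a \<Rightarrow> real" and n :: nat
    and \<beta> R C x\<^sub>0 :: real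
  assumes "std_brownian_motion M W" and "n \<ge> 1"
    and "\<beta> > 0" and "R > 0" and "C > 0" and "x\<^sub>0 \<in> {0..1}"
  shows "let P = white_noise_law M W n; F = holder_ball \<beta> R in
      (INF T\<in>class_T P F x\<^sub>0.
         (SUP f\<in>F. ennreal (\<bar>Bias P x\<^sub>0 T f\<bar> powr (1 / \<beta>))) \<cdot>\<^sub>\<infinity> (SUP f\<in>F. Var P T f))
        \<ge> gamma_const R \<beta> / of_nat n
    \<and> (INF T\<in>class_S P F x\<^sub>0 n \<beta> C.
         (SUP f\<in>F. ennreal (\<bar>Bias P x\<^sub>0 T f\<bar> powr (1 / \<beta>))) \<cdot>\<^sub>\<infinity>
         (INF f\<in>F. Var P T f /\<^sub>\<infinity> gamma_bar R \<beta> C (enn2real (holder_norm \<beta> {0..1} f))))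
        \<ge> 1 / of_nat n"
  unfolding Let_def
  by (intro conjI INF_greatest sup_variance_tradeoff pointwise_variance_tradeoff) (use assms in auto)

end
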